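(* Let $\gamma>0$, $0\le\alpha\le\beta$, $\mu>0$, $r\in\mathbb{N}$, and let $f\in C_\mu[0,\infty)$ be such that $f^{(r)}$ exists at a point $x\in(0,\infty)$. Then $$\lim_{n\to\infty}\frac{d^r}{dx^r}B_{n,\gamma}^{\alpha,\beta}(f,x)=f^{(r)}(x).$$
   Context: $C_\mu[0,\infty)=\{f\in C[0,\infty): |f(t)|\le Mt^{\mu}\text{ for some }M>0\}$. For $\gamma>0$, $n\in\mathbb{N}$, $k\in\mathbb{N}\cup\{0\}$, $x,t\in[0,\infty)$ let $$p_{n,k,\gamma}(x)=\frac{\Gamma(n/\gamma+k)}{\Gamma(k+1)\Gamma(n/\gamma)}\cdot\frac{(\gamma x)^k}{(1+\gamma x)^{n/\gamma+k}},\qquad b_{n,k,\gamma}(t)=\frac{\gamma\,\Gamma(n/\gamma+k+1)}{\Gamma(k)\Gamma(n/\gamma+1)}\cdot\frac{(\gamma t)^{k-1}}{(1+\gamma t)^{n/\gamma+k+1}}\ (k\ge1).$$ For $0\le\alpha\le\beta$ the Baskakov–Durrmeyer–Stancu operator is $$B_{n,\gamma}^{\alpha,\beta}(f,x)=\sum_{k=1}^{\infty}p_{n,k,\gamma}(x)\int_0^\infty b_{n,k,\gamma}(t)f\left(\frac{nt+\alpha}{n+\beta}\right)dt+p_{n,0,\gamma}(x)f\left(\frac{\alpha}{n+\beta}\right).$$ *)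

theory Defs
  imports "HOL-Analysis.Analysis"
begin

definition C_mu :: "real \<Rightarrow> (real \<Rightarrow> real) set" where
  "C_mu \<mu> = {f. continuous_on {0..} f \<and> (\<exists>M>0. \<forall>t\<ge>0. \<bar>f t\<bar> \<le> M * t powr \<mu>)}"

definition p_bas :: "nat \<Rightarrow> nat \<Rightarrow> real \<Rightarrow> real \<Rightarrow> real" where
  "p_bas n k \<gamma> x =
     Gamma (real n / \<gamma> + real k) / (Gamma (real k + 1) * Gamma (real n / \<gamma>)) *
     ((\<gamma> * x) ^ k / (1 + \<gamma> * x) powr (real n / \<gamma> + real k))"

definition b_bas :: "nat \<Rightarrow> nat \<Rightarrow> real \<Rightarrow> real \<Rightarrow> real" where
  "b_bas n k \<gamma> t =
     \<gamma> * Gamma (real n / \<gamma> + real k + 1) / (Gamma (real k) * Gamma (real n / \<gamma> + 1)) *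
     ((\<gamma> * t) ^ (k - 1) / (1 + \<gamma> * t) powr (real n / \<gamma> + real k + 1))"

definition BDS :: "nat \<Rightarrow> real \<Rightarrow> real \<Rightarrow> real \<Rightarrow> (real \<Rightarrow> real) \<Rightarrow> real \<Rightarrow> real" where
  "BDS n \<gamma> \<alpha> \<beta> f x =
     (\<Sum>k. p_bas n (Suc k) \<gamma> x *
        (LINT t:{0..}|lborel. b_bas n (Suc k) \<gamma> t * f ((real n * t + \<alpha>) / (real n + \<beta>))))
     + p_bas n 0 \<gamma> x * f (\<alpha> / (real n + \<beta>))"

end

(*
  Write the operator as a sum over k of p_{n,k}(x) d_k(f).  Split f = P + h, where P is the Taylor
  polynomial of degree r at x in the sense of Peano, so that h(u) = o(|u - x|^r).

  The operator maps P to a polynomial of degree at most r, and multiplies its coefficient of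
  degree r by a factor that tends to 1; this part of the r-th derivative is thus explicit.

  For h no derivative of the kernel is computed.  The function sum_k p_{n,k}(z) d_k(h) extends
  holomorphically to Re z > 0, and on the circle |z - x| = n^(-1/2) one has
    sum_k |p_{n,k}(z)| |d_k(h)| <= exp(2/x) sum_k p_{n,k}(xi) |d_k(h)|
  for a real point xi at distance O(n^(-1/2)) from x.  Since |u - x|^(2s) has mean O(n^(-s)) at
  such points, the right hand side is o(n^(-r/2)), and Cauchy's inequality on this circle
  makes the r-th derivative o(1).
*)
theory Submission
  imports Defs "HOL-Complex_Analysis.Complex_Analysis"
begin

section \<open>Moments of the beta prime weights\<close>

text \<open>The r-th derivative of \<open>f\<close> is only assumed at the single point x, so the
  sole information on the remainder is the pointwise bound h(u) = o(|u - x|^r), and every derivative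
  has to fall on the kernel. Differentiating the kernel r times would produce increasingly
  complicated polynomials in k and x; Cauchy's inequality asks only for a bound on moduli. The
  radius n^(-1/2) balances two effects. Off the real axis the kernel exceeds the real weights by a
  factor exp(O(n (Im z)^2)), which stays bounded for radii O(n^(-1/2)), while the loss n^(r/2) in
  Cauchy's inequality is exactly what an estimate o(n^(-r/2)) can pay. The price is that moment
  bounds at x itself do not suffice: they must be uniform over real points within O(n^(-1/2)) of x.
  Polynomial growth of \<open>f\<close> has two consequences. Convergence of the integrals is
  secured for n large against the degree of a dominating polynomial, whence hypotheses such as
  \<open>\<gamma> * real d \<le> real n\<close>. And away from x the remainder is dominated by |u -
  x|^(2N) with 2N > r, whose mean is smaller than n^(-r/2) by at least a further factor
  n^(-1/2).\<close>

lemma has_real_derivative_affine_powr: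
  fixes \<gamma> a t :: real
  assumes "1 + \<gamma> * t > 0"
  shows "((\<lambda>t. (1 + \<gamma> * t) powr a) has_real_derivative \<gamma> * (a * (1 + \<gamma> * t) powr (a - 1))) (at t)"
proof -
  have "((\<lambda>t. 1 + \<gamma> * t) has_real_derivative \<gamma>) (at t)"
    by (auto intro!: derivative_eq_intros)
  from DERIV_fun_powr[OF this assms, of a] show ?thesis by (simp add: mult_ac)
qed

text \<open>An antiderivative that vanishes at infinity has minus the integral over the half line as
  its value at 0. Integration by parts lowers j and c together, so \<open>c - real j - 1\<close> is
  constant along the induction; its positivity makes the boundary terms vanish at infinity.\<close>

lemma beta_prime_antiderivative:
  fixes \<gamma> c :: real
  assumes "\<gamma> > 0" "c > real j + 1"
  shows "\<exists>F. (\<forall>t\<ge>0. (F has_real_derivative (\<gamma> * t) ^ j * (1 + \<gamma> * t) powr (-c)) (at t)) \<and>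
             F 0 = - (fact j * Gamma (c - real j - 1) / (\<gamma> * Gamma c)) \<and> (F \<longlongrightarrow> 0) at_top"
  using assms(2)
proof (induction j arbitrary: c)
  case 0
  define F where "F = (\<lambda>t. - ((1 + \<gamma> * t) powr (1 - c) / (\<gamma> * (c - 1))))"
  have "(F has_real_derivative (\<gamma> * t) ^ 0 * (1 + \<gamma> * t) powr (-c)) (at t)" if "t \<ge> 0" for t
  proof -
    have "1 + \<gamma> * t > 0" using that assms(1) by (simp add: add_pos_nonneg)
    from DERIV_minus[OF DERIV_cdivide[OF has_real_derivative_affine_powr[OF this, of "1 - c"], of "\<gamma> * (c - 1)"]]
    show ?thesis
      unfolding F_def using 0 assms(1)
      by (auto simp: field_simps elim!: back_subst[where P="\<lambda>D. (_ has_real_derivative D) _"])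
  qed
  moreover have "F 0 = - (fact 0 * Gamma (c - real 0 - 1) / (\<gamma> * Gamma c))"
  proof -
    have "c - 1 > 0" using 0 by simp
    then have "Gamma c = (c - 1) * Gamma (c - 1)" "Gamma (c - 1) > 0"
      using Gamma_plus1[of "c - 1"] by (auto simp: nonpos_Ints_def)
    then show ?thesis by (simp add: F_def)
  qed
  moreover have "(F \<longlongrightarrow> 0) at_top"
    unfolding F_def using assms(1) 0 by real_asymp
  ultimately show ?case by blast
next
  case (Suc j)
  then obtain F where F: "\<And>t. t \<ge> 0 \<Longrightarrow> (F has_real_derivative (\<gamma> * t) ^ j * (1 + \<gamma> * t) powr (-(c - 1))) (at t)"
    "F 0 = - (fact j * Gamma (c - 1 - real j - 1) / (\<gamma> * Gamma (c - 1)))" "(F \<longlongrightarrow> 0) at_top"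
    using Suc.IH[of "c - 1"] by auto
  define G where "G = (\<lambda>t. real (j + 1) / (c - 1) * F t - (\<gamma> * t) ^ (j + 1) * (1 + \<gamma> * t) powr (1 - c) / (\<gamma> * (c - 1)))"
  have c: "c - 1 > 0" using Suc.prems by simp
  have "(G has_real_derivative (\<gamma> * t) ^ (Suc j) * (1 + \<gamma> * t) powr (-c)) (at t)" if "t \<ge> 0" for t
  proof -
    have pos: "1 + \<gamma> * t > 0" using that assms(1) by (simp add: add_pos_nonneg)
    have "((\<lambda>t. (\<gamma> * t) ^ (j + 1)) has_real_derivative \<gamma> * (real (j + 1) * (\<gamma> * t) ^ j)) (at t)"
      by (rule DERIV_cong, rule DERIV_power, rule DERIV_cmult, rule DERIV_ident) simp
    note D = DERIV_diff[OF DERIV_cmult[OF F(1)[OF that], of "real (j + 1) / (c - 1)"]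
      DERIV_cdivide[OF DERIV_mult'[OF this has_real_derivative_affine_powr[OF pos, of "1 - c"]], of "\<gamma> * (c - 1)"]]
    have "real (j + 1) / (c - 1) * ((\<gamma> * t) ^ j * (1 + \<gamma> * t) powr (-(c - 1))) -
       ((\<gamma> * t) ^ (j + 1) * (\<gamma> * ((1 - c) * (1 + \<gamma> * t) powr (1 - c - 1))) +
        \<gamma> * (real (j + 1) * (\<gamma> * t) ^ j) * (1 + \<gamma> * t) powr (1 - c)) / (\<gamma> * (c - 1))
       = (\<gamma> * t) ^ Suc j * (1 + \<gamma> * t) powr (-c)"
      using assms(1) c by (simp add: divide_simps) (simp add: algebra_simps)
    with D show ?thesis unfolding G_def by metis
  qed
  moreover have "G 0 = - (fact (Suc j) * Gamma (c - real (Suc j) - 1) / (\<gamma> * Gamma c))"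
  proof -
    have 1: "Gamma c = (c - 1) * Gamma (c - 1)"
      using Gamma_plus1[of "c - 1"] c by (auto simp: nonpos_Ints_def)
    have 2: "c - real (Suc j) - 1 = c - 1 - real j - 1" by simp
    show ?thesis unfolding G_def F(2) 1 2 by (simp add: mult_ac)
  qed
  moreover have "(G \<longlongrightarrow> 0) at_top"
  proof -
    have "((\<lambda>t. (\<gamma> * t) ^ (j + 1) * (1 + \<gamma> * t) powr (1 - c) / (\<gamma> * (c - 1))) \<longlongrightarrow> 0) at_top"
      using assms(1) Suc.prems by real_asymp
    then show ?thesis
      unfolding G_def using tendsto_diff[OF tendsto_mult_left[OF F(3), of "real (j + 1) / (c - 1)"]] by fastforce
  qed
  ultimately show ?case by blast
qed

lemma beta_prime_integral:
  fixes \<gamma> c :: real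
  assumes "\<gamma> > 0" "c > real j + 1"
  shows "set_integrable lborel {0..} (\<lambda>t. (\<gamma> * t) ^ j * (1 + \<gamma> * t) powr (-c))"
    and "(LINT t:{0..}|lborel. (\<gamma> * t) ^ j * (1 + \<gamma> * t) powr (-c)) = fact j * Gamma (c - real j - 1) / (\<gamma> * Gamma c)"
proof -
  define f where "f = (\<lambda>t. (\<gamma> * t) ^ j * (1 + \<gamma> * t) powr (-c))"
  obtain F where F: "\<And>t. t \<ge> 0 \<Longrightarrow> (F has_real_derivative f t) (at t)"
    "F 0 = - (fact j * Gamma (c - real j - 1) / (\<gamma> * Gamma c))" "(F \<longlongrightarrow> 0) at_top"
    using beta_prime_antiderivative[OF assms] unfolding f_def by blast
  have J: "fact j * Gamma (c - real j - 1) / (\<gamma> * Gamma c) \<ge> 0"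
    using assms by (intro divide_nonneg_nonneg mult_nonneg_nonneg) (auto intro: less_imp_le)
  \<comment> \<open>For a nonnegative integrand the fundamental theorem gives the value in the
    extended reals without prior integrability; finiteness then yields integrability.\<close>
  have nn: "(\<integral>\<^sup>+t. ennreal (f t) * indicator {0..} t \<partial>lborel) = ennreal (0 - F 0)"
    using assms(1) F by (intro nn_integral_FTC_atLeast) (auto simp: f_def)
  have "has_bochner_integral lborel (\<lambda>t. indicator {0..} t *\<^sub>R f t) (0 - F 0)"
  proof (rule has_bochner_integral_nn_integral)
    show "(\<lambda>t. indicator {0..} t *\<^sub>R f t) \<in> borel_measurable lborel" by (simp add: f_def)
    show "AE t in lborel. 0 \<le> indicator {0..} t *\<^sub>R f t"
      using assms(1) by (auto simp: f_def indicator_def)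
    show "0 \<le> 0 - F 0" using F(2) J by simp
    show "(\<integral>\<^sup>+t. ennreal (indicator {0..} t *\<^sub>R f t) \<partial>lborel) = ennreal (0 - F 0)"
      unfolding nn[symmetric] by (intro nn_integral_cong) (auto simp: indicator_def)
  qed
  then show "set_integrable lborel {0..} (\<lambda>t. (\<gamma> * t) ^ j * (1 + \<gamma> * t) powr (-c))"
    and "(LINT t:{0..}|lborel. (\<gamma> * t) ^ j * (1 + \<gamma> * t) powr (-c)) = fact j * Gamma (c - real j - 1) / (\<gamma> * Gamma c)"
    using F(2) unfolding f_def set_integrable_def set_lebesgue_integral_def
    by (auto simp: has_bochner_integral_iff)
qed

text \<open>The i-th moment of 1/\<gamma> times a beta prime variable with parameters k and
  n/\<gamma> + 1.\<close>

definition mom :: "real \<Rightarrow> nat \<Rightarrow> nat \<Rightarrow> nat \<Rightarrow> real" where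
  "mom \<gamma> n k i = pochhammer (real k) i / (\<Prod>j<i. real n - \<gamma> * real j)"

lemma b_bas_moment:
  assumes "\<gamma> > 0" "n > 0" "k > 0" "\<gamma> * real i \<le> real n"
  shows "set_integrable lborel {0..} (\<lambda>t. b_bas n k \<gamma> t * t ^ i)"
    and "(LINT t:{0..}|lborel. b_bas n k \<gamma> t * t ^ i) = mom \<gamma> n k i"
proof -
  define m where "m = real n / \<gamma>"
  have m: "m > 0" "m \<ge> real i" using assms by (auto simp: m_def field_simps)
  define c where "c = m + real k + 1"
  define C where "C = \<gamma> * Gamma (m + real k + 1) / (Gamma (real k) * Gamma (m + 1)) / \<gamma> ^ i"
  \<comment> \<open>Multiplication by t^i only raises the power of \<gamma> t and leaves c alone, so
    one integral formula covers all moments.\<close>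
  have eq: "b_bas n k \<gamma> t * t ^ i = C * ((\<gamma> * t) ^ (k - 1 + i) * (1 + \<gamma> * t) powr (-c))" for t
    using assms(1) by (simp add: b_bas_def C_def m_def[symmetric] c_def[symmetric] powr_minus_divide power_add power_mult_distrib)
  have cj: "c > real (k - 1 + i) + 1" using m assms(3) by (simp add: c_def of_nat_diff)
  note I = beta_prime_integral[OF assms(1) cj]
  show "set_integrable lborel {0..} (\<lambda>t. b_bas n k \<gamma> t * t ^ i)"
    unfolding eq using I(1) by simp
  have G1: "Gamma (real k + real i) = pochhammer (real k) i * Gamma (real k)"
  proof -
    have "Gamma (real k) > 0" using assms(3) by (intro Gamma_real_pos) simp
    then show ?thesis
      using pochhammer_Gamma[of "real k" i] assms(3)
      by (metis less_irrefl nonzero_eq_divide_eq of_nat_in_nonpos_Ints_iff)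
  qed
  have G2: "Gamma (m + 1) = (\<Prod>j<i. m - real j) * Gamma (m + 1 - real i)"
    using m(2)
  proof (induction i)
    case (Suc i)
    have "Gamma (m + 1 - real i) = (m - real i) * Gamma (m + 1 - real (Suc i))"
      using Gamma_plus1[of "m - real i"] Suc.prems by (auto simp: nonpos_Ints_def algebra_simps)
    then show ?case using Suc by simp
  qed simp
  have G3: "(\<Prod>j<i. real n - \<gamma> * real j) = \<gamma> ^ i * (\<Prod>j<i. m - real j)"
    using assms(1) by (induction i) (auto simp: m_def field_simps)
  have fk: "fact (k - 1 + i) = Gamma (real k + real i)"
    using Gamma_fact[of "k - 1 + i", where ?'a = real] assms(3) by (simp add: of_nat_diff add_ac)
  have ci: "c - real (k - 1 + i) - 1 = m + 1 - real i"
    using assms(3) by (simp add: c_def of_nat_diff)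
  have pos: "Gamma (m + 1 - real i) > 0" "Gamma c > 0" "Gamma (real k) > 0" "Gamma (m + 1) > 0"
    using m assms(3) by (auto simp: c_def intro!: Gamma_real_pos)
  have ne: "(\<Prod>j<i. m - real j) \<noteq> 0" using G2 pos(4) by (metis less_irrefl mult_zero_left)
  have "(LINT t:{0..}|lborel. b_bas n k \<gamma> t * t ^ i) =
    C * (Gamma (real k + real i) * Gamma (m + 1 - real i) / (\<gamma> * Gamma c))"
    unfolding eq using I(2)[unfolded fk ci] by simp
  also have "\<dots> = mom \<gamma> n k i"
    unfolding mom_def G1 G3 C_def c_def[symmetric] G2 using pos assms(1) ne
    by (simp add: field_simps)
  finally show "(LINT t:{0..}|lborel. b_bas n k \<gamma> t * t ^ i) = mom \<gamma> n k i" .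
qed

section \<open>The Durrmeyer functionals\<close>

text \<open>The atom at \<open>0\<close> is the right value for \<open>k = 0\<close>: with it the moment formula \<open>mom\<close> holds for all
  \<open>k\<close>, as \<open>pochhammer 0 i\<close> is \<open>1\<close> for \<open>i = 0\<close> and \<open>0\<close> otherwise.\<close>

definition dur :: "real \<Rightarrow> nat \<Rightarrow> nat \<Rightarrow> (real \<Rightarrow> real) \<Rightarrow> real" where
  "dur \<gamma> n k g = (if k = 0 then g 0 else LINT t:{0..}|lborel. b_bas n k \<gamma> t * g t)"

text \<open>A non-integrable function has integral 0 by default, so linearity and monotonicity of
  \<open>dur\<close> require this predicate. At k = 0 the functional is a point evaluation, defined
  for every function.\<close>

definition dur_ok :: "real \<Rightarrow> nat \<Rightarrow> nat \<Rightarrow> (real \<Rightarrow> real) \<Rightarrow> bool" where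
  "dur_ok \<gamma> n k g \<longleftrightarrow> k = 0 \<or> set_integrable lborel {0..} (\<lambda>t. b_bas n k \<gamma> t * g t)"

lemma b_bas_nonneg: "\<gamma> > 0 \<Longrightarrow> t \<ge> 0 \<Longrightarrow> k > 0 \<Longrightarrow> b_bas n k \<gamma> t \<ge> 0"
  unfolding b_bas_def
  by (intro mult_nonneg_nonneg divide_nonneg_nonneg) (auto intro!: less_imp_le[OF Gamma_real_pos] add_pos_nonneg add_nonneg_pos)

lemma dur_add:
  assumes "dur_ok \<gamma> n k g" "dur_ok \<gamma> n k h"
  shows "dur_ok \<gamma> n k (\<lambda>t. g t + h t)" "dur \<gamma> n k (\<lambda>t. g t + h t) = dur \<gamma> n k g + dur \<gamma> n k h"
  using assms by (auto simp: dur_ok_def dur_def distrib_left set_integral_add)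

lemma dur_cmult:
  assumes "dur_ok \<gamma> n k g"
  shows "dur_ok \<gamma> n k (\<lambda>t. c * g t)" "dur \<gamma> n k (\<lambda>t. c * g t) = c * dur \<gamma> n k g"
proof -
  have eq: "b_bas n k \<gamma> t * (c * g t) = c * (b_bas n k \<gamma> t * g t)" for t by simp
  show "dur_ok \<gamma> n k (\<lambda>t. c * g t)" "dur \<gamma> n k (\<lambda>t. c * g t) = c * dur \<gamma> n k g"
    using assms unfolding dur_ok_def dur_def eq by auto
qed

lemma dur_sum:
  assumes "finite I" "\<And>i. i \<in> I \<Longrightarrow> dur_ok \<gamma> n k (g i)"
  shows "dur_ok \<gamma> n k (\<lambda>t. \<Sum>i\<in>I. g i t) \<and> dur \<gamma> n k (\<lambda>t. \<Sum>i\<in>I. g i t) = (\<Sum>i\<in>I. dur \<gamma> n k (g i))"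
  using assms
proof (induction I rule: finite_induct)
  case empty
  then show ?case by (simp add: dur_ok_def dur_def set_integrable_def)
next
  case (insert i I)
  then have "dur_ok \<gamma> n k (g i)" "dur_ok \<gamma> n k (\<lambda>t. \<Sum>i\<in>I. g i t)"
    "dur \<gamma> n k (\<lambda>t. \<Sum>i\<in>I. g i t) = (\<Sum>i\<in>I. dur \<gamma> n k (g i))" by auto
  with dur_add[OF this(1,2)] insert.hyps show ?case by simp
qed

lemma dur_mono:
  assumes "\<gamma> > 0" "dur_ok \<gamma> n k g" "dur_ok \<gamma> n k h" "\<And>t. t \<ge> 0 \<Longrightarrow> g t \<le> h t"
  shows "dur \<gamma> n k g \<le> dur \<gamma> n k h"
  using assms unfolding dur_ok_def dur_def
  by (auto intro!: set_integral_mono mult_left_mono b_bas_nonneg)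

lemma dur_abs:
  assumes "\<gamma> > 0" "dur_ok \<gamma> n k g"
  shows "dur_ok \<gamma> n k (\<lambda>t. \<bar>g t\<bar>)" "\<bar>dur \<gamma> n k g\<bar> \<le> dur \<gamma> n k (\<lambda>t. \<bar>g t\<bar>)"
proof -
  show ok: "dur_ok \<gamma> n k (\<lambda>t. \<bar>g t\<bar>)"
  proof (cases "k = 0")
    case False
    then have "set_integrable lborel {0..} (\<lambda>t. \<bar>b_bas n k \<gamma> t * g t\<bar>)"
      using assms(2) by (intro set_integrable_abs) (auto simp: dur_ok_def)
    also have "?this \<longleftrightarrow> set_integrable lborel {0..} (\<lambda>t. b_bas n k \<gamma> t * \<bar>g t\<bar>)"
      using assms(1) False by (intro set_integrable_cong) (auto simp: abs_mult b_bas_nonneg)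
    finally show ?thesis by (simp add: dur_ok_def)
  qed (simp add: dur_ok_def)
  have "dur \<gamma> n k g \<le> dur \<gamma> n k (\<lambda>t. \<bar>g t\<bar>)"
    using ok assms by (intro dur_mono) auto
  moreover have "- dur \<gamma> n k g \<le> dur \<gamma> n k (\<lambda>t. \<bar>g t\<bar>)"
    using ok assms dur_cmult[OF assms(2), of "-1"] dur_mono[of \<gamma> n k "\<lambda>t. -1 * g t" "\<lambda>t. \<bar>g t\<bar>"] by auto
  ultimately show "\<bar>dur \<gamma> n k g\<bar> \<le> dur \<gamma> n k (\<lambda>t. \<bar>g t\<bar>)" by linarith
qed

lemma dur_power:
  assumes "\<gamma> > 0" "n > 0" "\<gamma> * real i \<le> real n"
  shows "dur_ok \<gamma> n k (\<lambda>t. t ^ i)" "dur \<gamma> n k (\<lambda>t. t ^ i) = mom \<gamma> n k i"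
  using b_bas_moment[OF assms(1,2) _ assms(3), of k]
  by (cases "k = 0"; auto simp: dur_ok_def dur_def mom_def pochhammer_0_left power_0_left)+

lemma dur_poly:
  assumes "\<gamma> > 0" "n > 0" "degree p \<le> d" "\<gamma> * real d \<le> real n"
  shows "dur_ok \<gamma> n k (poly p)" "dur \<gamma> n k (poly p) = (\<Sum>i\<le>d. coeff p i * mom \<gamma> n k i)"
proof -
  have p: "poly p = (\<lambda>t. \<Sum>i\<le>d. coeff p i * t ^ i)"
  proof
    fix t
    show "poly p t = (\<Sum>i\<le>d. coeff p i * t ^ i)"
      unfolding poly_altdef using assms(3)
      by (intro sum.mono_neutral_left) (auto simp: coeff_eq_0 not_le)
  qed
  have i: "\<gamma> * real i \<le> real n" if "i \<le> d" for i
    using that assms(1,4) by (meson mult_left_mono less_imp_le of_nat_le_iff order_trans)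
  have "dur_ok \<gamma> n k (\<lambda>t. coeff p i * t ^ i)" if "i \<le> d" for i
    using that by (intro dur_cmult dur_power assms i)
  then have "dur_ok \<gamma> n k (poly p) \<and> dur \<gamma> n k (poly p) = (\<Sum>i\<le>d. dur \<gamma> n k (\<lambda>t. coeff p i * t ^ i))"
    unfolding p by (intro dur_sum) auto
  moreover have "dur \<gamma> n k (\<lambda>t. coeff p i * t ^ i) = coeff p i * mom \<gamma> n k i" if "i \<le> d" for i
    using dur_cmult(2)[OF dur_power(1)] dur_power(2) assms i[OF that] by simp
  ultimately show "dur_ok \<gamma> n k (poly p)" "dur \<gamma> n k (poly p) = (\<Sum>i\<le>d. coeff p i * mom \<gamma> n k i)"
    by auto
qed

lemma dur_ok_bounded:
  assumes "\<gamma> > 0" "n > 0" "continuous_on {0..} g" "\<And>t. t \<ge> 0 \<Longrightarrow> \<bar>g t\<bar> \<le> poly p t" "\<gamma> * real (degree p) \<le> real n"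
  shows "dur_ok \<gamma> n k g"
proof (cases "k = 0")
  case False
  then have I: "set_integrable lborel {0..} (\<lambda>t. b_bas n k \<gamma> t * poly p t)"
    using dur_poly(1)[OF assms(1,2) order_refl assms(5), of k] by (simp add: dur_ok_def)
  have "set_integrable lborel {0..} (\<lambda>t. b_bas n k \<gamma> t * g t)"
  proof (rule set_integrable_bound[OF I])
    have "continuous_on {0..} (\<lambda>t. b_bas n k \<gamma> t * g t)"
      unfolding b_bas_def using assms(1,3)
      by (intro continuous_intros) (auto simp: add_nonneg_eq_0_iff)
    from borel_measurable_continuous_on_indicator[OF _ this]
    show "set_borel_measurable lborel {0..} (\<lambda>t. b_bas n k \<gamma> t * g t)"
      unfolding set_borel_measurable_def by simp
    show "AE t in lborel. t \<in> {0..} \<longrightarrow> norm (b_bas n k \<gamma> t * g t) \<le> norm (b_bas n k \<gamma> t * poly p t)"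
      using assms(1,4) False by (auto simp: abs_mult intro!: mult_left_mono AE_I2 order_trans[OF assms(4)])
  qed
  then show ?thesis by (simp add: dur_ok_def)
qed (simp add: dur_ok_def)

lemma mom_Suc:
  assumes "\<gamma> > 0" "\<gamma> * real (Suc i) \<le> real n"
  shows "(real n - \<gamma> * real i) * mom \<gamma> n k (Suc i) = (real k + real i) * mom \<gamma> n k i"
proof -
  have "real n - \<gamma> * real i \<noteq> 0" using assms by (simp add: algebra_simps)
  moreover have "mom \<gamma> n k (Suc i) = mom \<gamma> n k i * ((real k + real i) / (real n - \<gamma> * real i))"
    by (simp add: mom_def pochhammer_Suc)
  ultimately show ?thesis by simp
qed

text \<open>Integration by parts against the beta prime weight; by linearity it is \<open>mom_Suc\<close> on monomials,
  which also covers the atom at \<open>k = 0\<close>.\<close>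

lemma dur_by_parts:
  assumes "\<gamma> > 0" "n > 0" "\<gamma> * real (degree p + 1) \<le> real n"
  shows "dur \<gamma> n k (\<lambda>t. (real n * t - real k) * poly p t) =
         dur \<gamma> n k (\<lambda>t. t * (1 + \<gamma> * t) * poly (pderiv p) t)"
proof -
  define d where "d = degree p"
  \<comment> \<open>The density b satisfies the Pearson equation (t (1 + \<gamma> t) b(t))' = (k - n
    t) b(t); this pairs the factor n t - k with t (1 + \<gamma> t) times the derivative.\<close>
  define q1 where "q1 = [:- real k, real n:] * p"
  define q2 where "q2 = [:0, 1, \<gamma>:] * pderiv p"
  have "degree q1 \<le> d + 1" unfolding q1_def d_def by (rule order_trans[OF degree_mult_le]) auto
  moreover have "degree q2 \<le> d + 1"
  \<comment> \<open>For d = 0 the subtraction d - 1 truncates, and the generic bound 2 + (d - 1)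
    would be one too large.\<close>
  proof (cases "d = 0")
    case False
    have "degree q2 \<le> 2 + (d - 1)"
      unfolding q2_def d_def
      by (rule order_trans[OF degree_mult_le]) (auto simp: degree_pderiv)
    then show ?thesis using False by simp
  next
    case True
    then have "pderiv p = 0" by (simp add: d_def pderiv_eq_0_iff)
    then show ?thesis by (simp add: q2_def)
  qed
  ultimately have deg: "degree q1 \<le> Suc d" "degree q2 \<le> Suc d" by auto
  have sd: "\<gamma> * real (Suc d) \<le> real n" using assms(3) by (simp add: d_def)
  have c1: "coeff q1 i = real n * (if i = 0 then 0 else coeff p (i - 1)) - real k * coeff p i" for i
    by (cases i) (auto simp: q1_def coeff_pCons)
  have c2: "coeff q2 i = real i * coeff p i + \<gamma> * (real (i - 1) * (if i = 0 then 0 else coeff p (i - 1)))" for i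
    by (cases i; cases "i - 1") (auto simp: q2_def coeff_pCons coeff_pderiv)
  let ?M = "mom \<gamma> n k"
  \<comment> \<open>Lets the sums of unshifted coefficients run up to \<open>Suc d\<close> or stop
    at d at will, so that they can be matched with the shifted ones.\<close>
  have cs: "coeff p (Suc d) = 0" by (simp add: d_def coeff_eq_0)
  have "(\<Sum>i\<le>Suc d. coeff q1 i * ?M i) =
    (\<Sum>i\<le>Suc d. real n * (if i = 0 then 0 else coeff p (i - 1)) * ?M i) - (\<Sum>i\<le>Suc d. real k * coeff p i * ?M i)"
    by (simp add: c1 left_diff_distrib sum_subtractf)
  also have "\<dots> = (\<Sum>i\<le>d. coeff p i * (real n * ?M (Suc i) - real k * ?M i))"
    using cs by (subst sum.atMost_Suc_shift) (simp add: sum_subtractf algebra_simps)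
  also have "\<dots> = (\<Sum>i\<le>d. coeff p i * (real i * ?M i + \<gamma> * real i * ?M (Suc i)))"
  proof (rule sum.cong[OF refl])
    fix i assume "i \<in> {..d}"
    then have "\<gamma> * real (Suc i) \<le> real n"
      using sd assms(1) by (meson atMost_iff mult_left_mono less_imp_le of_nat_le_iff order_trans Suc_le_mono)
    from mom_Suc[OF assms(1) this, of k]
    show "coeff p i * (real n * ?M (Suc i) - real k * ?M i) = coeff p i * (real i * ?M i + \<gamma> * real i * ?M (Suc i))"
      by (simp add: algebra_simps)
  qed
  also have "\<dots> = (\<Sum>i\<le>Suc d. real i * coeff p i * ?M i) +
      (\<Sum>i\<le>Suc d. \<gamma> * (real (i - 1) * (if i = 0 then 0 else coeff p (i - 1))) * ?M i)"
    using cs by (subst (2) sum.atMost_Suc_shift) (simp add: sum.distrib algebra_simps)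
  also have "\<dots> = (\<Sum>i\<le>Suc d. coeff q2 i * ?M i)"
    by (simp add: c2 distrib_right sum.distrib)
  finally have "dur \<gamma> n k (poly q1) = dur \<gamma> n k (poly q2)"
    using dur_poly(2)[OF assms(1,2) deg(1) sd] dur_poly(2)[OF assms(1,2) deg(2) sd] by simp
  also have "poly q1 = (\<lambda>t. (real n * t - real k) * poly p t)"
    by (auto simp: q1_def fun_eq_iff algebra_simps)
  also have "poly q2 = (\<lambda>t. t * (1 + \<gamma> * t) * poly (pderiv p) t)"
    by (auto simp: q2_def fun_eq_iff algebra_simps)
  finally show ?thesis .
qed

section \<open>Central moments of the beta prime weights\<close>

lemma dur_central_ok:
  assumes "\<gamma> > 0" "n > 0" "\<gamma> * real j \<le> real n"
  shows "dur_ok \<gamma> n k (\<lambda>t. (t - a) ^ j)"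
proof -
  have "degree ([:-a, 1:] ^ j) \<le> j" by (simp add: degree_linear_power)
  moreover have "poly ([:-a, 1:] ^ j) = (\<lambda>t. (t - a) ^ j)" by (simp add: fun_eq_iff poly_power)
  ultimately show ?thesis using dur_poly(1)[OF assms(1,2) _ assms(3), of "[:-a, 1:] ^ j"] by metis
qed

text \<open>Integration by parts applied to (t - a)^(j+1), with t (1 + \<gamma> t) expanded about
  the mean a as a (1 + \<gamma> a) + (1 + 2 \<gamma> a) (t - a) + \<gamma> (t - a)^2. The quadratic
  term reproduces the moment of order j + 2 and moves to the left, which changes n into n - \<gamma>
  (j + 1).\<close>

lemma dur_central_Suc:
  fixes \<gamma> :: real and n k j :: nat
  assumes "\<gamma> > 0" "n > 0" "\<gamma> * real (j + 2) \<le> real n"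
  defines "a \<equiv> real k / real n"
  defines "\<mu> \<equiv> \<lambda>j. dur \<gamma> n k (\<lambda>t. (t - a) ^ j)"
  shows "(real n - \<gamma> * real (j + 1)) * \<mu> (j + 2) =
    real (j + 1) * ((1 + 2 * \<gamma> * a) * \<mu> (j + 1) + a * (1 + \<gamma> * a) * \<mu> j)"
proof -
  define p where "p = [:-a, 1:] ^ Suc j"
  have ok: "dur_ok \<gamma> n k (\<lambda>t. (t - a) ^ i)" if "i \<le> j + 2" for i
  proof -
    have "\<gamma> * real i \<le> \<gamma> * real (j + 2)" using that assms(1) by (intro mult_left_mono) auto
    then have "\<gamma> * real i \<le> real n" using assms(3) by linarith
    then show ?thesis by (intro dur_central_ok assms(1,2))
  qed
  have dp: "degree p = Suc j" unfolding p_def by (rule degree_linear_power)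
  have pd: "poly (pderiv p) t = real (j + 1) * (t - a) ^ j" for t
    unfolding p_def pderiv_power_Suc by (simp add: pderiv_pCons poly_power algebra_simps)
  have "real n * \<mu> (j + 2) = dur \<gamma> n k (\<lambda>t. real n * (t - a) ^ (j + 2))"
    unfolding \<mu>_def by (intro dur_cmult(2)[symmetric] ok) simp
  also have "\<dots> = dur \<gamma> n k (\<lambda>t. (real n * t - real k) * poly p t)"
    using assms(2) by (intro arg_cong[where f = "dur \<gamma> n k"]) (auto simp: p_def poly_power a_def field_simps fun_eq_iff)
  also have "\<dots> = dur \<gamma> n k (\<lambda>t. t * (1 + \<gamma> * t) * poly (pderiv p) t)"
    using assms by (intro dur_by_parts) (auto simp: dp algebra_simps)
  also have "\<dots> = dur \<gamma> n k (\<lambda>t. real (j + 1) * ((1 + 2 * \<gamma> * a) * (t - a) ^ (j + 1) +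
      (a * (1 + \<gamma> * a) * (t - a) ^ j + \<gamma> * (t - a) ^ (j + 2))))"
    unfolding pd by (intro arg_cong[where f = "dur \<gamma> n k"]) (auto simp: fun_eq_iff algebra_simps power2_eq_square)
  also have "\<dots> = real (j + 1) * ((1 + 2 * \<gamma> * a) * \<mu> (j + 1) + (a * (1 + \<gamma> * a) * \<mu> j + \<gamma> * \<mu> (j + 2)))"
  proof -
    have ok': "dur_ok \<gamma> n k (\<lambda>t. (t - a) ^ (j + 2))" "dur_ok \<gamma> n k (\<lambda>t. (t - a) ^ (j + 1))" "dur_ok \<gamma> n k (\<lambda>t. (t - a) ^ j)"
      by (rule ok; simp)+
    note 1 = dur_cmult[OF ok'(1), of \<gamma>] and 2 = dur_cmult[OF ok'(2), of "1 + 2 * \<gamma> * a"]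
      and 3 = dur_cmult[OF ok'(3), of "a * (1 + \<gamma> * a)"]
    note 4 = dur_add[OF 3(1) 1(1)]
    note 5 = dur_add[OF 2(1) 4(1)]
    show ?thesis
      unfolding \<mu>_def dur_cmult(2)[OF 5(1)] 5(2) 4(2) 1(2) 2(2) 3(2) ..
  qed
  finally show ?thesis by (simp add: algebra_simps)
qed

text \<open>Each use of the recursion raises the order by two and gains a factor 1/n, hence the
  scale sqrt n per order. The condition 2 \<gamma> j \<le> n keeps the divisor n - \<gamma> (j - 1)
  above n/2. The constant must not depend on k; the polynomial growth in k/n on the right is
  absorbed later by exponential moments.\<close>

lemma dur_central_bound:
  assumes "\<gamma> > 0"
  shows "\<exists>C\<ge>0. \<forall>n k. n > 0 \<longrightarrow> 2 * \<gamma> * real j \<le> real n \<longrightarrow>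
    sqrt (real n) ^ j * \<bar>dur \<gamma> n k (\<lambda>t. (t - real k / real n) ^ j)\<bar> \<le> C * ((1 + 2 * \<gamma>) * (1 + real k / real n)) ^ j"
proof (induction j rule: less_induct)
  case (less j)
  consider "j = 0" | "j = 1" | i where "j = i + 2"
    by (metis One_nat_def Suc_1 add_2_eq_Suc' not0_implies_Suc)
  then show ?case
  proof cases
    case 1
    have "dur \<gamma> n k (\<lambda>t. 1) = 1" if "n > 0" for n k
      using dur_power(2)[OF assms that, of 0 k] by (simp add: mom_def)
    then show ?thesis using 1 by (intro exI[of _ 1]) simp
  next
    case 2
    \<comment> \<open>The centre k/n is the exact mean, so the first central moment
      vanishes.\<close>
    have "dur \<gamma> n k (\<lambda>t. t - real k / real n) = 0" if "n > 0" "2 * \<gamma> \<le> real n" for n k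
    proof -
      have "\<gamma> * real 1 \<le> real n" "\<gamma> * real 0 \<le> real n" using that assms by auto
      note P = dur_power[OF assms that(1) this(1), of k] and P0 = dur_power[OF assms that(1) this(2), of k]
      have "dur \<gamma> n k (\<lambda>t. t ^ 1 + (- (real k / real n)) * t ^ 0) = mom \<gamma> n k 1 + (- (real k / real n)) * mom \<gamma> n k 0"
        unfolding dur_add(2)[OF P(1) dur_cmult(1)[OF P0(1)]] dur_cmult(2)[OF P0(1)] P(2) P0(2) ..
      moreover have "mom \<gamma> n k 1 = real k / real n" "mom \<gamma> n k 0 = 1" by (simp_all add: mom_def)
      ultimately show ?thesis by simp
    qed
    then show ?thesis using 2 by (intro exI[of _ 0]) simp
  next
    case (3 i)
    obtain C0 where C0: "C0 \<ge> 0" "\<And>n k. n > 0 \<Longrightarrow> 2 * \<gamma> * real i \<le> real n \<Longrightarrow>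
      sqrt (real n) ^ i * \<bar>dur \<gamma> n k (\<lambda>t. (t - real k / real n) ^ i)\<bar> \<le> C0 * ((1 + 2 * \<gamma>) * (1 + real k / real n)) ^ i"
      using less.IH[of i] 3 by auto
    obtain C1 where C1: "C1 \<ge> 0" "\<And>n k. n > 0 \<Longrightarrow> 2 * \<gamma> * real (i + 1) \<le> real n \<Longrightarrow>
      sqrt (real n) ^ (i + 1) * \<bar>dur \<gamma> n k (\<lambda>t. (t - real k / real n) ^ (i + 1))\<bar>
        \<le> C1 * ((1 + 2 * \<gamma>) * (1 + real k / real n)) ^ (i + 1)"
      using less.IH[of "i + 1"] 3 by auto
    have "sqrt (real n) ^ (i + 2) * \<bar>dur \<gamma> n k (\<lambda>t. (t - real k / real n) ^ (i + 2))\<bar>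
       \<le> (2 * real (i + 1) * (C1 + C0)) * ((1 + 2 * \<gamma>) * (1 + real k / real n)) ^ (i + 2)"
      if n: "n > 0" and nj: "2 * \<gamma> * real (i + 2) \<le> real n" for n k
    proof -
      define a where "a = real k / real n"
      \<comment> \<open>Chosen so that c dominates the coefficient 1 + 2 \<gamma> a and c^2
        dominates a (1 + \<gamma> a); both terms of the recursion then have the same degree in
        c.\<close>
      define c where "c = (1 + 2 * \<gamma>) * (1 + a)"
      define \<mu> where "\<mu> = (\<lambda>j. dur \<gamma> n k (\<lambda>t. (t - a) ^ j))"
      define \<rho> where "\<rho> = sqrt (real n)"
      have \<rho>: "\<rho> \<ge> 1" "\<rho> ^ 2 = real n" using n by (auto simp: \<rho>_def)
      have a: "a \<ge> 0" by (simp add: a_def)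
      have c: "c \<ge> 1 + 2 * \<gamma> * a" "c ^ 2 \<ge> a * (1 + \<gamma> * a)" "c \<ge> 0"
      proof -
        show 1: "c \<ge> 1 + 2 * \<gamma> * a" using a assms by (simp add: c_def algebra_simps)
        have 2: "c \<ge> a" using a assms by (simp add: c_def algebra_simps add_increasing)
        show "c \<ge> 0" using 2 a by simp
        have "\<gamma> * a \<ge> 0" using a assms by simp
        then have "1 + \<gamma> * a \<le> c" using 1 by linarith
        then have "a * (1 + \<gamma> * a) \<le> c * c" using 2 a \<open>\<gamma> * a \<ge> 0\<close> by (intro mult_mono) auto
        then show "c ^ 2 \<ge> a * (1 + \<gamma> * a)" by (simp add: power2_eq_square)
      qed
      have g: "\<gamma> * real (i + 2) \<le> real n" "2 * \<gamma> * real i \<le> real n" "2 * \<gamma> * real (i + 1) \<le> real n"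
        and h: "real n / 2 \<le> real n - \<gamma> * real (i + 1)"
        using nj assms by (auto simp: algebra_simps)
      have "real n / 2 * \<bar>\<mu> (i + 2)\<bar> \<le> (real n - \<gamma> * real (i + 1)) * \<bar>\<mu> (i + 2)\<bar>"
        by (rule mult_right_mono[OF h abs_ge_zero])
      also have "\<dots> = \<bar>(real n - \<gamma> * real (i + 1)) * \<mu> (i + 2)\<bar>"
      proof -
        have "real n - \<gamma> * real (i + 1) \<ge> 0" using h by linarith
        then show ?thesis by (simp only: abs_mult abs_of_nonneg)
      qed
      also have "\<dots> = \<bar>real (i + 1) * ((1 + 2 * \<gamma> * a) * \<mu> (i + 1) + a * (1 + \<gamma> * a) * \<mu> i)\<bar>"
        using dur_central_Suc[OF assms n g(1), of k] by (simp add: \<mu>_def a_def)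
      also have "\<dots> \<le> real (i + 1) * (c * \<bar>\<mu> (i + 1)\<bar> + c ^ 2 * \<bar>\<mu> i\<bar>)"
        unfolding abs_mult using c a assms
        by (auto simp: abs_mult intro!: mult_left_mono order_trans[OF abs_triangle_ineq] add_mono mult_right_mono)
      finally have *: "real n * \<bar>\<mu> (i + 2)\<bar> \<le> 2 * real (i + 1) * (c * \<bar>\<mu> (i + 1)\<bar> + c ^ 2 * \<bar>\<mu> i\<bar>)"
        by (simp add: field_simps)
      have "\<rho> ^ (i + 2) * \<bar>\<mu> (i + 2)\<bar> = \<rho> ^ i * (real n * \<bar>\<mu> (i + 2)\<bar>)"
        unfolding \<rho>(2)[symmetric] power_add by simp
      also have "\<dots> \<le> \<rho> ^ i * (2 * real (i + 1) * (c * \<bar>\<mu> (i + 1)\<bar> + c ^ 2 * \<bar>\<mu> i\<bar>))"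
        using * \<rho> by (intro mult_left_mono) auto
      also have "\<dots> = 2 * real (i + 1) * (c * (\<rho> ^ i * \<bar>\<mu> (i + 1)\<bar>) + c ^ 2 * (\<rho> ^ i * \<bar>\<mu> i\<bar>))"
        by (simp add: algebra_simps)
      also have "\<dots> \<le> 2 * real (i + 1) * (c * (C1 * c ^ (i + 1)) + c ^ 2 * (C0 * c ^ i))"
      proof -
        \<comment> \<open>The middle term of the recursion has a factor \<rho> to spare, which is
          given away since \<rho> \<ge> 1.\<close>
        have "\<rho> ^ i * \<bar>\<mu> (i + 1)\<bar> \<le> \<rho> ^ (i + 1) * \<bar>\<mu> (i + 1)\<bar>"
          using \<rho> by (intro mult_right_mono power_increasing) auto
        also have "\<dots> \<le> C1 * c ^ (i + 1)"
          using C1(2)[OF n g(3), of k] by (simp add: \<mu>_def a_def c_def \<rho>_def)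
        finally have "\<rho> ^ i * \<bar>\<mu> (i + 1)\<bar> \<le> C1 * c ^ (i + 1)" .
        moreover have "\<rho> ^ i * \<bar>\<mu> i\<bar> \<le> C0 * c ^ i"
          using C0(2)[OF n g(2), of k] by (simp add: \<mu>_def a_def c_def \<rho>_def)
        ultimately show ?thesis
          using c(3) by (intro mult_left_mono add_mono) auto
      qed
      also have "\<dots> = (2 * real (i + 1) * (C1 + C0)) * c ^ (i + 2)"
        by (simp add: algebra_simps power2_eq_square)
      finally show ?thesis by (simp add: \<mu>_def a_def c_def \<rho>_def)
    qed
    then show ?thesis
      using C0(1) C1(1) unfolding 3 by (intro exI[of _ "2 * real (i + 1) * (C1 + C0)"]) auto
  qed
qed

section \<open>Negative binomial weights\<close>

lemma negative_binomial_series: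
  fixes m w :: real
  assumes "\<bar>w\<bar> < 1"
  shows "(\<lambda>k. pochhammer m k / fact k * w ^ k) sums (1 - w) powr (-m)"
proof -
  have "(\<lambda>k. ((-m) gchoose k) * (-w) ^ k) sums (1 + (-w)) powr (-m)"
    using assms by (intro gen_binomial_real) simp
  also have "(\<lambda>k. ((-m) gchoose k) * (-w) ^ k) = (\<lambda>k. pochhammer m k / fact k * w ^ k)"
  proof
    fix k
    have "(-1) ^ k * (-w) ^ k = w ^ k" by (simp flip: power_mult_distrib)
    then show "((-m) gchoose k) * (-w) ^ k = pochhammer m k / fact k * w ^ k"
      by (simp add: gbinomial_pochhammer)
  qed
  finally show ?thesis by simp
qed

text \<open>These are the negative binomial weights with parameter n/\<gamma> and ratio \<gamma> x /
  (1 + \<gamma> x). Apart from a factor independent of k, the point x enters through the k-th power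
  of the ratio only, which is what makes the operator a power series.\<close>

lemma p_bas_eq:
  assumes "\<gamma> > 0" "n > 0" "x \<ge> 0"
  shows "p_bas n k \<gamma> x =
    pochhammer (real n / \<gamma>) k / fact k * (\<gamma> * x / (1 + \<gamma> * x)) ^ k * (1 + \<gamma> * x) powr (- (real n / \<gamma>))"
proof -
  define m where "m = real n / \<gamma>"
  have m: "m > 0" using assms by (simp add: m_def)
  have pos: "1 + \<gamma> * x > 0" using assms by (simp add: add_pos_nonneg)
  have "Gamma (m + real k) / Gamma m = pochhammer m k"
  proof -
    have "m \<notin> \<int>\<^sub>\<le>\<^sub>0" using m nonpos_Ints_nonpos[of m] by linarith
    from pochhammer_Gamma[OF this, of k] show ?thesis by simp
  qed
  moreover have "Gamma (m + real k) / (fact k * Gamma m) = (Gamma (m + real k) / Gamma m) / fact k" by simp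
  ultimately have 1: "Gamma (m + real k) / (fact k * Gamma m) = pochhammer m k / fact k" by metis
  have 2: "Gamma (real k + 1) = fact k"
    using Gamma_fact[of k, where ?'a = real] by (simp add: add_ac)
  have 3: "(1 + \<gamma> * x) powr (m + real k) = (1 + \<gamma> * x) powr m * (1 + \<gamma> * x) ^ k"
    using pos by (simp add: powr_add powr_realpow)
  have 4: "a * (c / (P * Q)) = a * (c / Q) * inverse P" for a c P Q :: real
    by (simp add: divide_inverse)
  show ?thesis
    unfolding p_bas_def m_def[symmetric] 1 2 3 4 power_divide powr_minus ..
qed

lemma p_bas_nonneg: "\<gamma> > 0 \<Longrightarrow> n > 0 \<Longrightarrow> x \<ge> 0 \<Longrightarrow> p_bas n k \<gamma> x \<ge> 0"
  by (subst p_bas_eq) (auto intro!: mult_nonneg_nonneg divide_nonneg_nonneg pochhammer_nonneg)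

text \<open>Serves two bases of the polynomials in k: falling factorials (\<open>c i\<close> equal
  to -i) and rising factorials (\<open>c i\<close> equal to i).\<close>

lemma monic_prod_linear:
  fixes c :: "nat \<Rightarrow> 'a :: idom"
  shows "degree (\<Prod>i<j. [:c i, 1:]) = j" "coeff (\<Prod>i<j. [:c i, 1:]) j = 1"
proof -
  have "degree (\<Prod>i<j. [:c i, 1:]) = j \<and> lead_coeff (\<Prod>i<j. [:c i, 1:]) = 1"
  proof (induction j)
    case (Suc j)
    define P where "P = (\<Prod>i<j. [:c i, 1:])"
    have P: "degree P = j" "lead_coeff P = 1" using Suc by (auto simp: P_def)
    then have "P \<noteq> 0" by auto
    then have "degree (P * [:c j, 1:]) = Suc j" using P(1) by (subst degree_mult_eq) auto
    moreover have "lead_coeff (P * [:c j, 1:]) = 1" unfolding lead_coeff_mult P(2) by simp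
    ultimately show ?case by (simp only: prod.lessThan_Suc P_def)
  qed simp
  then show "degree (\<Prod>i<j. [:c i, 1:]) = j" "coeff (\<Prod>i<j. [:c i, 1:]) j = 1" by metis+
qed

text \<open>Factorial moments. The falling product vanishes for k < j and otherwise cancels against
  k!, so that after the shift k = l + j a negative binomial series with parameter n/\<gamma> + j
  remains. The case j = 0 is the total mass 1.\<close>

lemma p_bas_falling_sums:
  assumes "\<gamma> > 0" "n > 0" "x \<ge> 0"
  shows "(\<lambda>k. p_bas n k \<gamma> x * (\<Prod>i<j. real k - real i)) sums (pochhammer (real n / \<gamma>) j * (\<gamma> * x) ^ j)"
proof -
  define m where "m = real n / \<gamma>"
  define y where "y = \<gamma> * x"
  define w where "w = y / (1 + y)"
  have y: "y \<ge> 0" using assms by (simp add: y_def)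
  have w: "\<bar>w\<bar> < 1" "1 - w = 1 / (1 + y)" using y by (auto simp: w_def field_simps)
  define f where "f = (\<lambda>k. p_bas n k \<gamma> x * (\<Prod>i<j. real k - real i))"
  have "f (l + j) = pochhammer m j * w ^ j * (1 + y) powr (-m) * (pochhammer (m + real j) l / fact l * w ^ l)" for l
  proof -
    have "(\<Prod>i<j. real (l + j) - real i) * fact l = fact (l + j)"
    proof -
      have "fact (l + j) = pochhammer (1::real) (l + j)" by (simp add: pochhammer_fact)
      also have "\<dots> = fact l * pochhammer (1 + real l) j" by (simp add: pochhammer_product' pochhammer_fact)
      also have "pochhammer (1 + real l) j = (\<Prod>i<j. real (l + j) - real i)"
        unfolding pochhammer_prod_rev
        by (intro prod.reindex_bij_witness[of _ "\<lambda>i. i + 1" "\<lambda>i. i - 1"]) (auto simp: of_nat_diff)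
      finally show ?thesis by simp
    qed
    then have "(\<Prod>i<j. real (l + j) - real i) / fact (l + j) = 1 / fact l"
      by (simp add: field_simps)
    moreover have "pochhammer m (l + j) = pochhammer m j * pochhammer (m + real j) l"
      using pochhammer_product'[of m j l] by (simp add: add.commute)
    moreover have "f (l + j) = pochhammer m (l + j) * w ^ (l + j) * (1 + y) powr (-m) *
        ((\<Prod>i<j. real (l + j) - real i) / fact (l + j))"
      unfolding f_def p_bas_eq[OF assms] m_def[symmetric] y_def[symmetric] w_def[symmetric] by simp
    ultimately show ?thesis by (simp only: power_add) simp
  qed
  moreover have "(\<lambda>l. pochhammer m j * w ^ j * (1 + y) powr (-m) * (pochhammer (m + real j) l / fact l * w ^ l))
     sums (pochhammer m j * w ^ j * (1 + y) powr (-m) * (1 - w) powr (-(m + real j)))"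
    by (intro sums_mult negative_binomial_series w)
  moreover have "w ^ j * (1 + y) powr (-m) * (1 - w) powr (-(m + real j)) = y ^ j"
  proof -
    have "(1 / (1 + y)) powr (- b) = (1 + y) powr b" for b
      using y by (simp add: powr_divide powr_minus)
    then have "(1 - w) powr (-(m + real j)) = (1 + y) powr (m + real j)" unfolding w(2) .
    also have "\<dots> = (1 + y) powr m * (1 + y) ^ j"
      using y by (simp add: powr_add powr_realpow)
    finally show ?thesis using y by (simp add: w_def powr_minus power_divide)
  qed
  ultimately have "(\<lambda>l. f (l + j)) sums (pochhammer m j * y ^ j)" by (simp add: mult.assoc)
  moreover have "f k = 0" if "k < j" for k
    using that by (auto simp: f_def)
  ultimately show ?thesis
    using sums_zero_iff_shift[of j f "pochhammer m j * y ^ j"] by (simp add: f_def m_def y_def)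
qed

text \<open>Falling factorials in k are mapped to multiples of powers of x, so the induction peels
  off the top one. Only the coefficient of degree d is tracked, since a d-th derivative sees nothing
  else of a polynomial of degree at most d.\<close>

lemma p_bas_poly_sums:
  assumes "\<gamma> > 0" "n > 0" "degree Q \<le> d"
  shows "\<exists>R. degree R \<le> d \<and> coeff R d = pochhammer (real n / \<gamma>) d * \<gamma> ^ d * coeff Q d \<and>
    (\<forall>x\<ge>0. (\<lambda>k. p_bas n k \<gamma> x * poly Q (real k)) sums poly R x)"
  using assms(3)
proof (induction d arbitrary: Q)
  case 0
  then obtain c where Q: "Q = [:c:]" by (metis degree_eq_zeroE le_zero_eq)
  have "(\<lambda>k. p_bas n k \<gamma> x * c) sums c" if "x \<ge> 0" for x
    using sums_mult2[OF p_bas_falling_sums[OF assms(1,2) that, of 0], of c] by simp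
  then show ?case by (intro exI[of _ Q]) (simp add: Q)
next
  case (Suc d)
  define F where "F = (\<Prod>i<Suc d. [:- real i, 1:])"
  have F: "degree F = Suc d" "coeff F (Suc d) = 1"
    unfolding F_def by (rule monic_prod_linear)+
  define c where "c = coeff Q (Suc d)"
  have "coeff (Q - smult c F) i = 0" if "i > d" for i
  proof (cases "i = Suc d")
    case False
    then show ?thesis using that F(1) Suc.prems by (simp add: coeff_eq_0)
  qed (simp add: F c_def)
  then have "degree (Q - smult c F) \<le> d" by (intro degree_le) auto
  from Suc.IH[OF this] obtain R where R: "degree R \<le> d"
    "\<And>x. x \<ge> 0 \<Longrightarrow> (\<lambda>k. p_bas n k \<gamma> x * poly (Q - smult c F) (real k)) sums poly R x" by blast
  define e where "e = pochhammer (real n / \<gamma>) (Suc d) * \<gamma> ^ Suc d * c"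
  define R' where "R' = R + monom e (Suc d)"
  have "(\<lambda>k. p_bas n k \<gamma> x * poly Q (real k)) sums poly R' x" if "x \<ge> 0" for x
  proof -
    have pF: "poly F (real k) = (\<Prod>i<Suc d. real k - real i)" for k
      unfolding F_def poly_prod by simp
    have "(\<lambda>k. p_bas n k \<gamma> x * poly (Q - smult c F) (real k) + c * (p_bas n k \<gamma> x * (\<Prod>i<Suc d. real k - real i)))
      sums (poly R x + c * (pochhammer (real n / \<gamma>) (Suc d) * (\<gamma> * x) ^ Suc d))"
      by (intro sums_add sums_mult R(2) p_bas_falling_sums assms that)
    also have "(\<lambda>k. p_bas n k \<gamma> x * poly (Q - smult c F) (real k) + c * (p_bas n k \<gamma> x * (\<Prod>i<Suc d. real k - real i)))
      = (\<lambda>k. p_bas n k \<gamma> x * poly Q (real k))"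
      unfolding pF[symmetric] by (simp add: algebra_simps)
    also have "poly R x + c * (pochhammer (real n / \<gamma>) (Suc d) * (\<gamma> * x) ^ Suc d) = poly R' x"
      unfolding R'_def e_def power_mult_distrib by (simp add: poly_monom)
    finally show ?thesis .
  qed
  moreover have "degree R' \<le> Suc d"
    unfolding R'_def using R(1) by (intro degree_add_le) (auto intro: degree_monom_le)
  moreover have "coeff R' (Suc d) = e"
    using R(1) by (simp add: R'_def coeff_eq_0)
  ultimately show ?case unfolding e_def c_def by blast
qed

text \<open>As a function of k, the moment of t^i is a multiple of a rising factorial, whereas the
  summation over k prefers falling ones. No change of basis is computed: both are monic, so the
  leading coefficients multiply.\<close>

lemma dur_poly_eq_poly:
  assumes "\<gamma> > 0" "n > 0" "degree P \<le> d" "\<gamma> * real d \<le> real n"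
  shows "\<exists>Q. degree Q \<le> d \<and> coeff Q d = coeff P d / (\<Prod>j<d. real n - \<gamma> * real j) \<and>
    (\<forall>k. dur \<gamma> n k (poly P) = poly Q (real k))"
proof -
  define F where "F = (\<lambda>i. \<Prod>j<i. [:real j, 1:])"
  define D where "D = (\<lambda>i. \<Prod>j<i. real n - \<gamma> * real j)"
  define Q where "Q = (\<Sum>i\<le>d. smult (coeff P i / D i) (F i))"
  have F: "degree (F i) = i" "coeff (F i) i = 1" for i unfolding F_def by (rule monic_prod_linear)+
  have "degree Q \<le> d"
    unfolding Q_def using F(1) by (intro degree_sum_le) (auto intro: order_trans[OF degree_smult_le])
  moreover have "coeff Q d = (\<Sum>i\<le>d. if i = d then coeff P d / D d else 0)"
    unfolding Q_def coeff_sum using F by (intro sum.cong) (auto simp: coeff_eq_0)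
  moreover have "dur \<gamma> n k (poly P) = poly Q (real k)" for k
  proof -
    have "poly (F i) (real k) = pochhammer (real k) i" for i
      unfolding F_def poly_prod pochhammer_prod by (auto intro!: prod.cong)
    then show ?thesis
      unfolding Q_def dur_poly(2)[OF assms] poly_sum by (simp add: mom_def D_def)
  qed
  ultimately show ?thesis unfolding D_def by auto
qed

section \<open>Exponential moments of the negative binomial weights\<close>

lemma exp_minus_one_bounds:
  fixes u :: real
  assumes "\<bar>u\<bar> \<le> 1"
  shows "u \<le> exp u - 1" "exp u - 1 \<le> u + u ^ 2" "\<bar>exp u - 1\<bar> \<le> 2 * \<bar>u\<bar>"
proof -
  show 1: "u \<le> exp u - 1" using exp_ge_add_one_self[of u] by linarith
  show 2: "exp u - 1 \<le> u + u ^ 2"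
  proof (cases "u \<ge> 0")
    case True
    then show ?thesis using exp_bound[of u] assms by auto
  next
    case False
    \<comment> \<open>For negative u the quadratic Taylor bound exp v \<ge> 1 + v + v^2/2 is
      inverted: its product with 1 - v + v^2 is at least 1.\<close>
    define v where "v = - u"
    have v: "v \<ge> 0" "v \<le> 1" using False assms by (auto simp: v_def)
    have "1 \<le> (1 - v + v ^ 2) * (1 + v + v ^ 2 / 2)"
    proof -
      have "(1 - v + v ^ 2) * (1 + v + v ^ 2 / 2) = 1 + v ^ 2 / 2 + v ^ 3 / 2 + v ^ 4 / 2"
        by (simp add: field_simps power2_eq_square power3_eq_cube power4_eq_xxxx)
      then show ?thesis using v by simp
    qed
    also have "\<dots> \<le> (1 - v + v ^ 2) * exp v"
      using v exp_lower_Taylor_quadratic[of v] by (intro mult_left_mono) auto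
    finally have "exp u \<le> 1 - v + v ^ 2" by (simp add: v_def exp_minus field_simps)
    then show ?thesis by (simp add: v_def)
  qed
  have "u ^ 2 \<le> \<bar>u\<bar>" using assms mult_left_mono[of "\<bar>u\<bar>" 1 "\<bar>u\<bar>"] by (simp add: power2_eq_square)
  with 1 2 show "\<bar>exp u - 1\<bar> \<le> 2 * \<bar>u\<bar>" by linarith
qed

text \<open>Chernoff bound: for \<open>\<theta> = \<plusminus>1 / sqrt m\<close> the exponential moments of the centred negative binomial
  weights stay bounded, which controls all their central moments at once.\<close>

lemma p_bas_exp_sums:
  assumes "\<gamma> > 0" "n > 0" "x \<ge> 0"
  defines "m \<equiv> real n / \<gamma>" and "y \<equiv> \<gamma> * x"
  assumes \<theta>: "m * \<theta> ^ 2 = 1" and large: "4 * (1 + y) \<le> sqrt m"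
  shows "\<exists>S\<le>exp (y + 8 * y ^ 2). (\<lambda>k. p_bas n k \<gamma> x * exp (\<theta> * (real k - m * y))) sums S"
proof -
  have m: "m > 0" and y: "y \<ge> 0" using assms by (auto simp: m_def y_def)
  have \<theta>': "\<bar>\<theta>\<bar> * sqrt m = 1"
    using arg_cong[OF \<theta>, of sqrt] m by (simp add: real_sqrt_mult mult.commute)
  have "\<bar>\<theta>\<bar> * (4 * (1 + y)) \<le> 1" using mult_left_mono[OF large, of "\<bar>\<theta>\<bar>"] \<theta>' by simp
  then have t: "\<bar>\<theta>\<bar> \<le> 1" "4 * (y * \<bar>\<theta>\<bar>) \<le> 1"
    using mult_nonneg_nonneg[OF abs_ge_zero[of \<theta>] y] by (auto simp: algebra_simps)
  note E = exp_minus_one_bounds[OF t(1)]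
  \<comment> \<open>With this g one has 1 - w exp \<theta> = (1 - g) / (1 + y), so the powers of 1 +
    y cancel and the uncentred generating function is (1 - g)^(-m). The hypothesis
    \<open>large\<close> gives |g| \<le> 1/2, where the logarithm may be expanded.\<close>
  define g where "g = y * (exp \<theta> - 1)"
  have g1: "\<bar>g\<bar> \<le> 2 * (y * \<bar>\<theta>\<bar>)"
    using mult_left_mono[OF E(3) y] y by (simp add: g_def abs_mult)
  have g: "\<bar>g\<bar> \<le> 1 / 2" using g1 t(2) by linarith
  have g2: "g ^ 2 \<le> 4 * y ^ 2 * \<theta> ^ 2"
    using power_mono[OF g1, of 2] by (simp add: power_mult_distrib)
  have g3: "g \<le> y * \<theta> + y * \<theta> ^ 2"
    using mult_left_mono[OF E(2) y] by (simp add: g_def algebra_simps)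
  define w where "w = y / (1 + y)"
  have w: "1 - w * exp \<theta> = (1 - g) / (1 + y)" "\<bar>w * exp \<theta>\<bar> < 1"
  proof -
    show 1: "1 - w * exp \<theta> = (1 - g) / (1 + y)" using y by (simp add: w_def g_def field_simps)
    have "(1 - g) / (1 + y) > 0" using g y by (intro divide_pos_pos) auto
    moreover have "w * exp \<theta> \<ge> 0" using y by (simp add: w_def)
    ultimately show "\<bar>w * exp \<theta>\<bar> < 1" using 1 by linarith
  qed
  have "(\<lambda>k. (1 + y) powr (-m) * exp (- \<theta> * m * y) * (pochhammer m k / fact k * (w * exp \<theta>) ^ k))
     sums ((1 + y) powr (-m) * exp (- \<theta> * m * y) * (1 - w * exp \<theta>) powr (-m))"
    by (intro sums_mult negative_binomial_series w)
  also have "(\<lambda>k. (1 + y) powr (-m) * exp (- \<theta> * m * y) * (pochhammer m k / fact k * (w * exp \<theta>) ^ k)) =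
     (\<lambda>k. p_bas n k \<gamma> x * exp (\<theta> * (real k - m * y)))"
  proof
    fix k
    have "exp (\<theta> * (real k - m * y)) = exp (real k * \<theta> + (- \<theta> * m * y))" by (simp add: algebra_simps)
    also have "\<dots> = exp \<theta> ^ k * exp (- \<theta> * m * y)" by (simp only: exp_add exp_of_nat_mult)
    finally show "(1 + y) powr (-m) * exp (- \<theta> * m * y) * (pochhammer m k / fact k * (w * exp \<theta>) ^ k) =
      p_bas n k \<gamma> x * exp (\<theta> * (real k - m * y))"
      unfolding p_bas_eq[OF assms(1-3)] m_def[symmetric] y_def[symmetric] w_def[symmetric]
      by (simp add: power_mult_distrib)
  qed
  finally have S: "(\<lambda>k. p_bas n k \<gamma> x * exp (\<theta> * (real k - m * y)))
    sums ((1 + y) powr (-m) * exp (- \<theta> * m * y) * (1 - w * exp \<theta>) powr (-m))" .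
  have "(1 + y) powr (-m) * exp (- \<theta> * m * y) * (1 - w * exp \<theta>) powr (-m) = exp (- \<theta> * m * y) * (1 - g) powr (-m)"
    unfolding w(1) using y g by (simp add: powr_divide)
  also have "\<dots> = exp (- \<theta> * m * y - m * ln (1 - g))"
    using g by (simp add: powr_def exp_diff exp_minus field_simps)
  \<comment> \<open>The linear part \<theta> m y of -m ln (1 - g) cancels against the centring; what
    is left is of second order in \<theta>, and m \<theta>^2 = 1 turns it into a constant.\<close>
  also have "\<dots> \<le> exp (y + 8 * y ^ 2)"
  proof -
    have "\<bar>ln (1 + (- g)) - (- g)\<bar> \<le> 2 * (- g) ^ 2"
      using g by (intro abs_ln_one_plus_x_minus_x_bound) simp
    then have "- ln (1 - g) \<le> g + 2 * g ^ 2" by simp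
    also have "\<dots> \<le> y * \<theta> + (y + 8 * y ^ 2) * \<theta> ^ 2" using g2 g3 by (simp add: algebra_simps)
    finally have "m * (- ln (1 - g)) \<le> m * (y * \<theta> + (y + 8 * y ^ 2) * \<theta> ^ 2)"
      using m by (intro mult_left_mono) auto
    also have "\<dots> = \<theta> * m * y + (m * \<theta> ^ 2) * (y + 8 * y ^ 2)" by (simp add: algebra_simps)
    finally show ?thesis using \<theta> by simp
  qed
  finally show ?thesis using S by blast
qed

lemma power_le_fact_exp:
  fixes u :: real
  assumes "u \<ge> 0"
  shows "u ^ N \<le> fact N * exp u"
proof -
  have "u ^ N / fact N \<le> (\<Sum>k. u ^ k / fact k)"
    using sum_le_suminf[OF summable_exp[of u], of "{N}"] assms
    by (simp add: divide_inverse mult.commute)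
  also have "\<dots> = exp u" by (simp add: exp_def divide_inverse mult.commute)
  finally show ?thesis by (simp add: field_simps)
qed

section \<open>Moments of the operator near a point\<close>

text \<open>The coefficients d_k of the operator. At k = 0 the atom of \<open>dur\<close> at 0
  becomes evaluation at \<alpha> / (n + \<beta>), the separate summand in
  \<open>BDS\<close>.\<close>

definition bdk :: "real \<Rightarrow> real \<Rightarrow> real \<Rightarrow> nat \<Rightarrow> nat \<Rightarrow> (real \<Rightarrow> real) \<Rightarrow> real" where
  "bdk \<gamma> \<alpha> \<beta> n k h = dur \<gamma> n k (\<lambda>t. h ((real n * t + \<alpha>) / (real n + \<beta>)))"

lemma BDS_eq_suminf:
  assumes "summable (\<lambda>k. p_bas n k \<gamma> x * bdk \<gamma> \<alpha> \<beta> n k f)"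
  shows "BDS n \<gamma> \<alpha> \<beta> f x = (\<Sum>k. p_bas n k \<gamma> x * bdk \<gamma> \<alpha> \<beta> n k f)"
  using suminf_split_head[OF assms] by (simp add: BDS_def bdk_def dur_def)

lemma even_power_add_le:
  fixes p q :: real
  shows "(p + q) ^ (2 * s) \<le> 2 ^ (2 * s) * (p ^ (2 * s) + q ^ (2 * s))"
proof -
  have "(p + q) ^ (2 * s) = \<bar>p + q\<bar> ^ (2 * s)" by (simp add: power_even_abs)
  also have "\<dots> \<le> (2 * max \<bar>p\<bar> \<bar>q\<bar>) ^ (2 * s)" by (intro power_mono) auto
  also have "\<dots> = 2 ^ (2 * s) * max \<bar>p\<bar> \<bar>q\<bar> ^ (2 * s)" by (simp add: power_mult_distrib)
  also have "max \<bar>p\<bar> \<bar>q\<bar> ^ (2 * s) \<le> p ^ (2 * s) + q ^ (2 * s)"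
    by (cases "\<bar>p\<bar> \<le> \<bar>q\<bar>") (auto simp: max_def power_even_abs)
  finally show ?thesis by simp
qed

lemma poly_affine_power:
  fixes n :: nat
  shows "(\<lambda>t. ((real n * t + \<alpha>) / (real n + \<beta>) - x) ^ N) =
    poly ([:\<alpha> / (real n + \<beta>) - x, real n / (real n + \<beta>):] ^ N)"
  by (auto simp: fun_eq_iff poly_power add_divide_distrib algebra_simps)

lemma bdk_central_ok:
  assumes "\<gamma> > 0" "n > 0" "\<gamma> * real N \<le> real n"
  shows "dur_ok \<gamma> n k (\<lambda>t. ((real n * t + \<alpha>) / (real n + \<beta>) - x) ^ N)"
proof -
  have "degree ([:\<alpha> / (real n + \<beta>) - x, real n / (real n + \<beta>):] ^ N) \<le> 1 * N"
    by (rule order_trans[OF degree_power_le]) (auto intro: mult_right_mono)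
  then show ?thesis
    unfolding poly_affine_power using assms by (intro dur_poly(1)) auto
qed

text \<open>The distance of u from x has two sources: the spread of t about k/n, and the distance of
  k/n from x together with the Stancu shift. Measured in units of n^(-1/2), each is bounded in the
  mean by a power of 1 + |v|, where v is the rescaled deviation of k from its mean at \<xi>; such
  powers are dominated by exponentials of v and -v, whose means are bounded. Uniformity in \<xi> is
  needed because each point of the Cauchy circle leads to its own real point.\<close>

lemma bdk_moment_bound:
  fixes \<gamma> \<alpha> \<beta> x c :: real
  assumes \<gamma>: "\<gamma> > 0" and \<alpha>\<beta>: "0 \<le> \<alpha>" "\<alpha> \<le> \<beta>" and x: "x > 0" and c: "c \<ge> 0"
  shows "\<exists>C\<ge>0. \<exists>n0>0. \<forall>n\<ge>n0. \<forall>\<xi>\<ge>0. sqrt (real n) * \<bar>\<xi> - x\<bar> \<le> c \<longrightarrow>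
    summable (\<lambda>k. p_bas n k \<gamma> \<xi> * bdk \<gamma> \<alpha> \<beta> n k (\<lambda>u. (u - x) ^ (2 * s))) \<and>
    sqrt (real n) ^ (2 * s) * (\<Sum>k. p_bas n k \<gamma> \<xi> * bdk \<gamma> \<alpha> \<beta> n k (\<lambda>u. (u - x) ^ (2 * s))) \<le> C"
proof -
  define N where "N = 2 * s"
  obtain Cb where Cb: "Cb \<ge> 0" "\<And>n k. n > 0 \<Longrightarrow> 2 * \<gamma> * real N \<le> real n \<Longrightarrow>
    sqrt (real n) ^ N * \<bar>dur \<gamma> n k (\<lambda>t. (t - real k / real n) ^ N)\<bar> \<le> Cb * ((1 + 2 * \<gamma>) * (1 + real k / real n)) ^ N"
    using dur_central_bound[OF \<gamma>, of N] by auto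
  \<comment> \<open>X bounds every admissible \<xi>, as sqrt n \<ge> 1. With V = 1 + |v|, K1 bounds
    sqrt n |e| / V below: its terms stem from the deviation of k/n from \<xi>, the distance of \<xi>
    from x, and the Stancu shift. K2 bounds (1 + k/n) / V, K3 combines both, and
    \<open>fact N * exp 1\<close> in K comes from bounding V^N by N! exp V.\<close>
  define X where "X = x + c"
  define K1 where "K1 = 1 / sqrt \<gamma> + c + \<bar>\<alpha> - \<beta> * x\<bar>"
  define K2 where "K2 = 1 + X + 1 / sqrt \<gamma>"
  define K3 where "K3 = 2 ^ N * (Cb * ((1 + 2 * \<gamma>) * K2) ^ N + K1 ^ N)"
  define K where "K = K3 * fact N * exp 1"
  define C where "C = K * (2 * exp (\<gamma> * X + 8 * (\<gamma> * X) ^ 2))"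
  have X: "X > 0" using x c by (simp add: X_def)
  have Ks: "K1 \<ge> 0" "K2 \<ge> 0" "K3 \<ge> 0" "K \<ge> 0" "C \<ge> 0"
    using \<gamma> X c Cb(1) by (auto simp: K1_def K2_def K3_def K_def C_def)
  \<comment> \<open>The first threshold is that of \<open>dur_central_bound\<close>; the second
    states 4 (1 + \<gamma> X) \<le> sqrt (n/\<gamma>), as \<open>p_bas_exp_sums\<close> requires at
    every \<xi> \<le> X. \<open>Suc\<close> ensures n > 0.\<close>
  define n0 where "n0 = Suc (nat \<lceil>max (2 * \<gamma> * real N) (16 * \<gamma> * (1 + \<gamma> * X) ^ 2)\<rceil>)"
  show ?thesis
  proof (intro exI[of _ C] exI[of _ n0] conjI allI impI)
    show "C \<ge> 0" by fact
    show "n0 > 0" by (simp add: n0_def)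
    fix n \<xi> assume "n0 \<le> n" and \<xi>: "\<xi> \<ge> 0" "sqrt (real n) * \<bar>\<xi> - x\<bar> \<le> c"
    have "max (2 * \<gamma> * real N) (16 * \<gamma> * (1 + \<gamma> * X) ^ 2) \<le> real n" and n: "n > 0"
      using \<open>n0 \<le> n\<close> unfolding n0_def by linarith+
    then have n1: "2 * \<gamma> * real N \<le> real n" and n2: "16 * \<gamma> * (1 + \<gamma> * X) ^ 2 \<le> real n" by auto
    have n3: "\<gamma> * real N \<le> real n" using n1 \<gamma> mult_nonneg_nonneg[of \<gamma> "real N"] by linarith
    define \<rho> where "\<rho> = sqrt (real n)"
    have \<rho>: "\<rho> \<ge> 1" "\<rho> * \<rho> = real n" using n by (auto simp: \<rho>_def)
    define m where "m = real n / \<gamma>"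
    have m: "m > 0" using n \<gamma> by (simp add: m_def)
    have sm: "sqrt m = \<rho> / sqrt \<gamma>" by (simp add: m_def \<rho>_def real_sqrt_divide)
    \<comment> \<open>Scaled by sqrt m rather than by the standard deviation sqrt (m y (1 + y)),
      where y = \<gamma> \<xi>, to match \<theta> = 1 / sqrt m in the exponential moments.\<close>
    define v where "v = (\<lambda>k. (real k - m * (\<gamma> * \<xi>)) / sqrt m)"
    have my: "m * (\<gamma> * \<xi>) = real n * \<xi>" using \<gamma> by (simp add: m_def)
    have \<xi>X: "\<xi> \<le> X"
    proof -
      have "\<bar>\<xi> - x\<bar> \<le> \<rho> * \<bar>\<xi> - x\<bar>" using \<rho>(1) mult_right_mono[of 1 \<rho> "\<bar>\<xi> - x\<bar>"] by simp
      then show ?thesis using \<xi>(2) unfolding X_def \<rho>_def by linarith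
    qed
    define I where "I = (\<lambda>k. bdk \<gamma> \<alpha> \<beta> n k (\<lambda>u. (u - x) ^ N))"
    have pointwise: "0 \<le> I k \<and> \<rho> ^ N * I k \<le> K * (exp (v k) + exp (- v k))" for k
    proof -
      define a where "a = real k / real n"
      define V where "V = 1 + \<bar>v k\<bar>"
      \<comment> \<open>e collects the deviation of k/n from x and the Stancu shift, so that the
        transformed argument minus x is q times (t - a) + e; the contraction q \<le> 1 is then
        dropped.\<close>
      define e where "e = a - x + (\<alpha> - \<beta> * x) / real n"
      define q where "q = real n / (real n + \<beta>)"
      have V: "V \<ge> 1" by (simp add: V_def)
      have l: "0 \<le> q" "q \<le> 1" using n \<alpha>\<beta> by (auto simp: q_def field_simps)
      have u: "(real n * t + \<alpha>) / (real n + \<beta>) - x = q * ((t - a) + e)" for t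
      proof -
        have "real n + \<beta> \<noteq> 0" "real n \<noteq> 0" using n \<alpha>\<beta> by auto
        moreover from this have "q * ((t - a) + e) = (real n * t + (\<alpha> - \<beta> * x) - real n * x) / (real n + \<beta>)"
          by (simp add: q_def e_def algebra_simps add_divide_distrib diff_divide_distrib)
        ultimately show ?thesis by (simp add: divide_simps algebra_simps)
      qed
      have av: "\<rho> * (a - \<xi>) = v k / sqrt \<gamma>"
      proof -
        have "v k / sqrt \<gamma> = (real k - real n * \<xi>) / \<rho>"
          unfolding v_def my sm using \<gamma> by simp
        also have "\<dots> = \<rho> * (a - \<xi>)"
          using \<rho> n by (simp add: a_def field_simps flip: \<rho>(2))
        finally show ?thesis by simp
      qed
      have va: "\<rho> * \<bar>a - \<xi>\<bar> = \<bar>v k\<bar> / sqrt \<gamma>"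
        using arg_cong[OF av, of abs] \<rho>(1) \<gamma> by (simp add: abs_mult)
      have "\<rho> * \<bar>e\<bar> \<le> \<rho> * (\<bar>a - \<xi>\<bar> + \<bar>\<xi> - x\<bar> + \<bar>\<alpha> - \<beta> * x\<bar> / real n)"
      proof (intro mult_left_mono)
        have "e = (a - \<xi>) + (\<xi> - x) + (\<alpha> - \<beta> * x) / real n" by (simp add: e_def)
        moreover have "\<bar>(\<alpha> - \<beta> * x) / real n\<bar> = \<bar>\<alpha> - \<beta> * x\<bar> / real n" by simp
        ultimately show "\<bar>e\<bar> \<le> \<bar>a - \<xi>\<bar> + \<bar>\<xi> - x\<bar> + \<bar>\<alpha> - \<beta> * x\<bar> / real n" by linarith
      qed (use \<rho> in simp)
      also have "\<dots> = \<bar>v k\<bar> / sqrt \<gamma> + \<rho> * \<bar>\<xi> - x\<bar> + \<bar>\<alpha> - \<beta> * x\<bar> / \<rho>"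
        using va \<rho> n by (simp add: distrib_left flip: \<rho>(2))
      also have "\<dots> \<le> \<bar>v k\<bar> / sqrt \<gamma> + c + \<bar>\<alpha> - \<beta> * x\<bar>"
        using \<xi>(2) \<rho>(1) divide_left_mono[of 1 \<rho> "\<bar>\<alpha> - \<beta> * x\<bar>"] by (simp add: \<rho>_def)
      also have "\<dots> \<le> K1 * V"
      proof -
        have "c * \<bar>v k\<bar> \<ge> 0" "\<bar>\<alpha> - \<beta> * x\<bar> * \<bar>v k\<bar> \<ge> 0" "1 / sqrt \<gamma> \<ge> 0" using c \<gamma> by auto
        then show ?thesis by (simp add: K1_def V_def algebra_simps)
      qed
      finally have e: "\<rho> * \<bar>e\<bar> \<le> K1 * V" .
      have eN: "\<rho> ^ N * e ^ N \<le> K1 ^ N * V ^ N"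
      proof -
        have "\<rho> ^ N * e ^ N = (\<rho> * \<bar>e\<bar>) ^ N" by (simp add: N_def power_mult_distrib power_even_abs)
        also have "\<dots> \<le> (K1 * V) ^ N" using e \<rho> by (intro power_mono) auto
        finally show ?thesis by (simp add: power_mult_distrib)
      qed
      have "1 + a \<le> K2 * V"
      proof -
        have "\<bar>a - \<xi>\<bar> \<le> \<rho> * \<bar>a - \<xi>\<bar>" using \<rho>(1) mult_right_mono[of 1 \<rho> "\<bar>a - \<xi>\<bar>"] by simp
        then have "1 + a \<le> 1 + X + \<bar>v k\<bar> / sqrt \<gamma>" using va \<xi>X by linarith
        also have "\<dots> \<le> K2 * V"
        proof -
          have "X * \<bar>v k\<bar> \<ge> 0" "1 / sqrt \<gamma> \<ge> 0" using X \<gamma> by auto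
          then show ?thesis by (simp add: K2_def V_def algebra_simps)
        qed
        finally show ?thesis .
      qed
      then have aN: "((1 + 2 * \<gamma>) * (1 + a)) ^ N \<le> ((1 + 2 * \<gamma>) * K2) ^ N * V ^ N"
        unfolding power_mult_distrib[symmetric] mult.assoc
        using \<gamma> by (intro power_mono mult_left_mono mult_nonneg_nonneg) (auto simp: a_def)
      have ok: "dur_ok \<gamma> n k (\<lambda>t. (t - a) ^ N)" by (rule dur_central_ok[OF \<gamma> n n3])
      \<comment> \<open>The constant is written as a multiple of t^0 so that
        \<open>dur_power\<close> supplies its value.\<close>
      have okc: "dur_ok \<gamma> n k (\<lambda>t. e ^ N * t ^ 0)"
        by (intro dur_cmult dur_power \<gamma> n) simp
      have okI: "dur_ok \<gamma> n k (\<lambda>t. ((real n * t + \<alpha>) / (real n + \<beta>) - x) ^ N)"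
        by (rule bdk_central_ok[OF \<gamma> n n3])
      have dc: "dur \<gamma> n k (\<lambda>t. e ^ N * t ^ 0) = e ^ N"
        using dur_cmult(2)[OF dur_power(1)[OF \<gamma> n, of 0 k], of "e ^ N"] dur_power(2)[OF \<gamma> n, of 0 k]
        by (simp add: mom_def)
      have I0: "0 \<le> I k"
      proof -
        have "0 = 0 * dur \<gamma> n k (\<lambda>t. t ^ 0)" by simp
        also have "\<dots> = dur \<gamma> n k (\<lambda>t. 0 * t ^ 0)"
          by (intro dur_cmult(2)[symmetric] dur_power \<gamma> n) simp
        also have "\<dots> \<le> I k"
          unfolding I_def bdk_def
          by (intro dur_mono dur_cmult dur_power okI \<gamma> n) (auto simp: N_def)
        finally show ?thesis by simp
      qed
      have "I k \<le> dur \<gamma> n k (\<lambda>t. 2 ^ N * ((t - a) ^ N + e ^ N * t ^ 0))"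
        unfolding I_def bdk_def
      proof (rule dur_mono[OF \<gamma> okI dur_cmult(1)[OF dur_add(1)[OF ok okc]]])
        fix t :: real
        have "((real n * t + \<alpha>) / (real n + \<beta>) - x) ^ N = q ^ N * ((t - a) + e) ^ N"
          unfolding u by (simp add: power_mult_distrib)
        also have "\<dots> \<le> 1 * ((t - a) + e) ^ N"
          using l by (intro mult_right_mono power_le_one) (auto simp: N_def)
        also have "\<dots> \<le> 2 ^ N * ((t - a) ^ N + e ^ N * t ^ 0)"
          using even_power_add_le[of "t - a" e s] by (simp add: N_def)
        finally show "((real n * t + \<alpha>) / (real n + \<beta>) - x) ^ N \<le> 2 ^ N * ((t - a) ^ N + e ^ N * t ^ 0)" .
      qed
      also have "\<dots> = 2 ^ N * (dur \<gamma> n k (\<lambda>t. (t - a) ^ N) + e ^ N)"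
        unfolding dur_cmult(2)[OF dur_add(1)[OF ok okc]] dur_add(2)[OF ok okc] dc ..
      finally have "\<rho> ^ N * I k \<le> \<rho> ^ N * (2 ^ N * (dur \<gamma> n k (\<lambda>t. (t - a) ^ N) + e ^ N))"
        using \<rho> by (intro mult_left_mono) auto
      also have "\<dots> = 2 ^ N * (\<rho> ^ N * dur \<gamma> n k (\<lambda>t. (t - a) ^ N) + \<rho> ^ N * e ^ N)"
        by (simp add: algebra_simps)
      also have "\<dots> \<le> 2 ^ N * (Cb * (((1 + 2 * \<gamma>) * K2) ^ N * V ^ N) + K1 ^ N * V ^ N)"
      proof (intro mult_left_mono add_mono eN)
        have "\<rho> ^ N * dur \<gamma> n k (\<lambda>t. (t - a) ^ N) \<le> \<rho> ^ N * \<bar>dur \<gamma> n k (\<lambda>t. (t - a) ^ N)\<bar>"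
          using \<rho> by (intro mult_left_mono) auto
        also have "\<dots> \<le> Cb * ((1 + 2 * \<gamma>) * (1 + a)) ^ N"
          using Cb(2)[OF n n1, of k] by (simp add: \<rho>_def a_def)
        also have "\<dots> \<le> Cb * (((1 + 2 * \<gamma>) * K2) ^ N * V ^ N)"
          by (rule mult_left_mono[OF aN Cb(1)])
        finally show "\<rho> ^ N * dur \<gamma> n k (\<lambda>t. (t - a) ^ N) \<le> Cb * (((1 + 2 * \<gamma>) * K2) ^ N * V ^ N)" .
      qed simp
      also have "\<dots> = K3 * V ^ N" by (simp add: K3_def algebra_simps)
      also have "\<dots> \<le> K3 * (fact N * exp V)"
        using V Ks by (intro mult_left_mono power_le_fact_exp) auto
      also have "\<dots> = K * exp \<bar>v k\<bar>" by (simp add: K_def V_def exp_add)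
      \<comment> \<open>Removes the modulus; hence the exponential moments for both signs of
        \<theta>, and the factor 2 in C.\<close>
      also have "\<dots> \<le> K * (exp (v k) + exp (- v k))"
        using Ks by (intro mult_left_mono) (auto simp: abs_if)
      finally show ?thesis using I0 by simp
    qed
    have E: "\<exists>S\<le>exp (\<gamma> * X + 8 * (\<gamma> * X) ^ 2). (\<lambda>k. p_bas n k \<gamma> \<xi> * exp (\<theta> * (real k - m * (\<gamma> * \<xi>)))) sums S"
      if "\<theta> ^ 2 = 1 / m" for \<theta>
    proof -
      have "4 * (1 + \<gamma> * \<xi>) \<le> sqrt m"
      proof (rule real_le_rsqrt)
        have "(4 * (1 + \<gamma> * \<xi>)) ^ 2 \<le> (4 * (1 + \<gamma> * X)) ^ 2"
          using \<gamma> \<xi> \<xi>X by (intro power_mono) auto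
        also have "\<dots> = 16 * (1 + \<gamma> * X) ^ 2" by (subst power_mult_distrib) simp
        also have "\<dots> \<le> m" using n2 \<gamma> by (simp add: m_def pos_le_divide_eq mult_ac)
        finally show "(4 * (1 + \<gamma> * \<xi>)) ^ 2 \<le> m" .
      qed
      moreover have "m * \<theta> ^ 2 = 1" using that m by simp
      ultimately obtain S where S: "S \<le> exp (\<gamma> * \<xi> + 8 * (\<gamma> * \<xi>) ^ 2)"
        "(\<lambda>k. p_bas n k \<gamma> \<xi> * exp (\<theta> * (real k - m * (\<gamma> * \<xi>)))) sums S"
        using p_bas_exp_sums[OF \<gamma> n \<xi>(1), of \<theta>, folded m_def] by blast
      moreover have "exp (\<gamma> * \<xi> + 8 * (\<gamma> * \<xi>) ^ 2) \<le> exp (\<gamma> * X + 8 * (\<gamma> * X) ^ 2)"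
        using \<gamma> \<xi> \<xi>X by (auto intro!: add_mono mult_left_mono power_mono)
      ultimately show ?thesis by (blast intro: order_trans)
    qed
    obtain S1 where S1: "S1 \<le> exp (\<gamma> * X + 8 * (\<gamma> * X) ^ 2)" "(\<lambda>k. p_bas n k \<gamma> \<xi> * exp (v k)) sums S1"
      using E[of "1 / sqrt m"] m by (auto simp: v_def power_divide)
    obtain S2 where S2: "S2 \<le> exp (\<gamma> * X + 8 * (\<gamma> * X) ^ 2)" "(\<lambda>k. p_bas n k \<gamma> \<xi> * exp (- v k)) sums S2"
      using E[of "- (1 / sqrt m)"] m by (auto simp: v_def power_divide)
    have S: "(\<lambda>k. K * (p_bas n k \<gamma> \<xi> * exp (v k) + p_bas n k \<gamma> \<xi> * exp (- v k))) sums (K * (S1 + S2))"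
      by (intro sums_mult sums_add S1 S2)
    have le: "\<rho> ^ N * (p_bas n k \<gamma> \<xi> * I k) \<le> K * (p_bas n k \<gamma> \<xi> * exp (v k) + p_bas n k \<gamma> \<xi> * exp (- v k))" for k
    proof -
      have "p_bas n k \<gamma> \<xi> * (\<rho> ^ N * I k) \<le> p_bas n k \<gamma> \<xi> * (K * (exp (v k) + exp (- v k)))"
        using pointwise[of k] p_bas_nonneg[OF \<gamma> n \<xi>(1)] by (intro mult_left_mono) auto
      then show ?thesis by (simp add: algebra_simps)
    qed
    have pos: "0 \<le> p_bas n k \<gamma> \<xi> * I k" for k
      using pointwise[of k] p_bas_nonneg[OF \<gamma> n \<xi>(1)] by simp
    have \<rho>N: "\<rho> ^ N \<ge> 1" using \<rho> by simp
    have "p_bas n k \<gamma> \<xi> * I k \<le> K * (p_bas n k \<gamma> \<xi> * exp (v k) + p_bas n k \<gamma> \<xi> * exp (- v k))" for k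
      using mult_right_mono[OF \<rho>N pos[of k]] le[of k] by linarith
    then have sI: "summable (\<lambda>k. p_bas n k \<gamma> \<xi> * I k)"
      using pos by (intro summable_comparison_test'[OF sums_summable[OF S], of 0]) auto
    then show "summable (\<lambda>k. p_bas n k \<gamma> \<xi> * bdk \<gamma> \<alpha> \<beta> n k (\<lambda>u. (u - x) ^ (2 * s)))"
      by (simp add: I_def N_def)
    have "\<rho> ^ N * (\<Sum>k. p_bas n k \<gamma> \<xi> * I k) = (\<Sum>k. \<rho> ^ N * (p_bas n k \<gamma> \<xi> * I k))"
      by (rule suminf_mult[OF sI, symmetric])
    also have "\<dots> \<le> (\<Sum>k. K * (p_bas n k \<gamma> \<xi> * exp (v k) + p_bas n k \<gamma> \<xi> * exp (- v k)))"
      by (intro suminf_le le summable_mult sI sums_summable[OF S])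
    also have "\<dots> = K * (S1 + S2)" using S by (rule sums_unique[symmetric])
    also have "\<dots> \<le> C" unfolding C_def using S1(1) S2(1) Ks by (intro mult_left_mono) auto
    finally show "sqrt (real n) ^ (2 * s) * (\<Sum>k. p_bas n k \<gamma> \<xi> * bdk \<gamma> \<alpha> \<beta> n k (\<lambda>u. (u - x) ^ (2 * s))) \<le> C"
      by (simp add: I_def N_def \<rho>_def)
  qed
qed

section \<open>Polynomials and Taylor expansion\<close>

lemma coeff_pcompose_linear:
  fixes P :: "real poly"
  assumes "degree P \<le> r" "b \<noteq> 0"
  shows "degree (pcompose P [:a, b:]) \<le> r" "coeff (pcompose P [:a, b:]) r = coeff P r * b ^ r"
proof -
  have d: "degree (pcompose P [:a, b:]) = degree P" using assms(2) by (simp add: degree_pcompose)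
  show "degree (pcompose P [:a, b:]) \<le> r" using d assms(1) by simp
  show "coeff (pcompose P [:a, b:]) r = coeff P r * b ^ r"
  proof (cases "degree P = r")
    case True
    then show ?thesis using lead_coeff_comp[of "[:a, b:]" P] d assms(2) by simp
  next
    case False
    then show ?thesis using d assms(1) by (simp add: coeff_eq_0)
  qed
qed

text \<open>The power of n / (n + \<beta>) comes from the Stancu scaling, the factors n + \<gamma> j
  from the factorial moments of the weights in k, the factors n - \<gamma> j from the beta prime
  moments.\<close>

definition lead_factor :: "real \<Rightarrow> real \<Rightarrow> nat \<Rightarrow> nat \<Rightarrow> real" where
  "lead_factor \<gamma> \<beta> r n = (real n / (real n + \<beta>)) ^ r * (\<Prod>j<r. (real n + \<gamma> * real j) / (real n - \<gamma> * real j))"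

lemma lead_factor_tendsto: "(\<lambda>n. lead_factor \<gamma> \<beta> r n) \<longlonglongrightarrow> 1"
proof -
  have "(\<lambda>n. (real n + \<gamma> * real j) / (real n - \<gamma> * real j)) \<longlonglongrightarrow> 1" for j by real_asymp
  then have "(\<lambda>n. \<Prod>j<r. (real n + \<gamma> * real j) / (real n - \<gamma> * real j)) \<longlonglongrightarrow> (\<Prod>j<r. 1)"
    by (intro tendsto_prod)
  moreover have "(\<lambda>n. real n / (real n + \<beta>)) \<longlonglongrightarrow> 1" by real_asymp
  ultimately have "(\<lambda>n. lead_factor \<gamma> \<beta> r n) \<longlonglongrightarrow> 1 ^ r * (\<Prod>j<r. 1)"
    unfolding lead_factor_def by (intro tendsto_mult tendsto_power)
  then show ?thesis by simp
qed

lemma bdk_poly_sums: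
  assumes "\<gamma> > 0" "\<beta> \<ge> 0" "n > 0" "degree P \<le> r" "\<gamma> * real r \<le> real n"
  shows "\<exists>R. degree R \<le> r \<and> coeff R r = lead_factor \<gamma> \<beta> r n * coeff P r \<and>
    (\<forall>x\<ge>0. (\<lambda>k. p_bas n k \<gamma> x * bdk \<gamma> \<alpha> \<beta> n k (poly P)) sums poly R x)"
proof -
  define b where "b = real n / (real n + \<beta>)"
  define q where "q = pcompose P [:\<alpha> / (real n + \<beta>), b:]"
  have "b \<noteq> 0" using assms by (simp add: b_def)
  note q = coeff_pcompose_linear[OF assms(4) this, of "\<alpha> / (real n + \<beta>)", folded q_def]
  have bdk: "bdk \<gamma> \<alpha> \<beta> n k (poly P) = dur \<gamma> n k (poly q)" for k
    unfolding bdk_def by (intro arg_cong[where f = "dur \<gamma> n k"])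
      (auto simp: fun_eq_iff q_def poly_pcompose b_def add_divide_distrib algebra_simps)
  obtain Q where Q: "degree Q \<le> r" "coeff Q r = coeff q r / (\<Prod>j<r. real n - \<gamma> * real j)"
    "\<And>k. dur \<gamma> n k (poly q) = poly Q (real k)"
    using dur_poly_eq_poly[OF assms(1,3) q(1) assms(5)] by blast
  obtain R where R: "degree R \<le> r" "coeff R r = pochhammer (real n / \<gamma>) r * \<gamma> ^ r * coeff Q r"
    "\<And>x. x \<ge> 0 \<Longrightarrow> (\<lambda>k. p_bas n k \<gamma> x * poly Q (real k)) sums poly R x"
    using p_bas_poly_sums[OF assms(1,3) Q(1)] by blast
  have "pochhammer (real n / \<gamma>) r * \<gamma> ^ r = (\<Prod>j<r. real n + \<gamma> * real j)"
    using assms(1) by (induction r) (auto simp: pochhammer_Suc field_simps)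
  then have "coeff R r = lead_factor \<gamma> \<beta> r n * coeff P r"
    unfolding R(2) Q(2) q(2) lead_factor_def prod_dividef b_def by simp
  with R show ?thesis unfolding bdk Q(3) by blast
qed

lemma poly_antiderivative:
  fixes P :: "real poly"
  assumes "degree P \<le> r"
  shows "\<exists>Q. pderiv Q = P \<and> degree Q \<le> Suc r \<and> coeff Q (Suc r) = coeff P r / real (Suc r) \<and> poly Q x = c"
proof -
  define Q0 where "Q0 = (\<Sum>i\<le>r. monom (coeff P i / real (Suc i)) (Suc i))"
  define Q where "Q = Q0 + [:c - poly Q0 x:]"
  have "pderiv Q0 = (\<Sum>i\<le>r. monom (coeff P i) i)"
    unfolding Q0_def using higher_pderiv_sum[of 1 "\<lambda>i. monom (coeff P i / real (Suc i)) (Suc i)" "{..r}"]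
    by (simp add: pderiv_monom del: of_nat_Suc)
  also have "\<dots> = P" by (rule poly_as_sum_of_monoms'[OF assms])
  finally have "pderiv Q = P" by (simp add: Q_def pderiv_add pderiv_pCons)
  moreover have "degree Q0 \<le> Suc r"
    unfolding Q0_def by (intro degree_sum_le) (auto intro!: order_trans[OF degree_monom_le])
  then have "degree Q \<le> Suc r" unfolding Q_def by (intro degree_add_le) auto
  moreover have "coeff Q (Suc r) = coeff P r / real (Suc r)"
  proof -
    have "coeff Q (Suc r) = (\<Sum>i\<le>r. if i = r then coeff P r / real (Suc r) else 0)"
      unfolding Q_def Q0_def by (simp add: coeff_sum)
    then show ?thesis by simp
  qed
  moreover have "poly Q x = c" by (simp add: Q_def)
  ultimately show ?thesis by blast
qed

lemma taylor_peano:
  fixes f :: "real \<Rightarrow> real"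
  assumes "e > 0" "\<And>j y. j < r \<Longrightarrow> y \<in> ball x e \<Longrightarrow> ((deriv ^^ j) f) differentiable (at y)"
    and "((deriv ^^ r) f) differentiable (at x)"
  shows "\<exists>P. degree P \<le> Suc r \<and> fact (Suc r) * coeff P (Suc r) = (deriv ^^ Suc r) f x \<and>
    (\<forall>\<epsilon>>0. \<exists>d>0. \<forall>u. \<bar>u - x\<bar> < d \<longrightarrow> \<bar>f u - poly P u\<bar> \<le> \<epsilon> * \<bar>u - x\<bar> ^ Suc r)"
  using assms(2,3)
proof (induction r arbitrary: f)
  case 0
  then have D: "(f has_real_derivative deriv f x) (at x)"
    by (simp add: DERIV_deriv_iff_real_differentiable)
  define P where "P = [:f x - deriv f x * x, deriv f x:]"
  have "\<exists>d>0. \<forall>u. \<bar>u - x\<bar> < d \<longrightarrow> \<bar>f u - poly P u\<bar> \<le> \<epsilon> * \<bar>u - x\<bar>" if \<epsilon>: "\<epsilon> > 0" for \<epsilon>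
  proof -
    obtain d where d: "d > 0" "\<And>u. norm (u - x) < d \<Longrightarrow> norm (f u - f x - deriv f x * (u - x)) \<le> \<epsilon> * norm (u - x)"
      using D[unfolded has_field_derivative_def has_derivative_at_alt, THEN conjunct2, rule_format, OF \<epsilon>] by blast
    have P: "f u - poly P u = f u - f x - deriv f x * (u - x)" for u by (simp add: P_def algebra_simps)
    have "\<forall>u. \<bar>u - x\<bar> < d \<longrightarrow> \<bar>f u - poly P u\<bar> \<le> \<epsilon> * \<bar>u - x\<bar>" unfolding P using d(2) by simp
    with d(1) show ?thesis by blast
  qed
  then show ?case by (intro exI[of _ P]) (auto simp: P_def)
next
  case (Suc r)
  have shift: "(deriv ^^ j) (deriv f) = (deriv ^^ Suc j) f" for j by (simp add: funpow_swap1)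
  have "\<And>j y. j < r \<Longrightarrow> y \<in> ball x e \<Longrightarrow> ((deriv ^^ j) (deriv f)) differentiable (at y)"
    unfolding shift by (intro Suc.prems(1)) auto
  moreover have "((deriv ^^ r) (deriv f)) differentiable (at x)"
    unfolding shift by (rule Suc.prems(2))
  ultimately obtain P where P: "degree P \<le> Suc r" "fact (Suc r) * coeff P (Suc r) = (deriv ^^ Suc r) (deriv f) x"
    "\<And>\<epsilon>. \<epsilon> > 0 \<Longrightarrow> \<exists>d>0. \<forall>u. \<bar>u - x\<bar> < d \<longrightarrow> \<bar>deriv f u - poly P u\<bar> \<le> \<epsilon> * \<bar>u - x\<bar> ^ Suc r"
    using Suc.IH[of "deriv f"] by blast
  obtain Q where Q: "pderiv Q = P" "degree Q \<le> Suc (Suc r)"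
    "coeff Q (Suc (Suc r)) = coeff P (Suc r) / real (Suc (Suc r))" "poly Q x = f x"
    using poly_antiderivative[OF P(1), of x "f x"] by blast
  have "\<exists>d>0. \<forall>u. \<bar>u - x\<bar> < d \<longrightarrow> \<bar>f u - poly Q u\<bar> \<le> \<epsilon> * \<bar>u - x\<bar> ^ Suc (Suc r)" if \<epsilon>: "\<epsilon> > 0" for \<epsilon>
  proof -
    obtain d where d: "d > 0" "\<And>u. \<bar>u - x\<bar> < d \<Longrightarrow> \<bar>deriv f u - poly P u\<bar> \<le> \<epsilon> * \<bar>u - x\<bar> ^ Suc r"
      using P(3)[OF \<epsilon>] by blast
    have "\<bar>f u - poly Q u\<bar> \<le> \<epsilon> * \<bar>u - x\<bar> ^ Suc (Suc r)" if u: "\<bar>u - x\<bar> < min d e" for u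
    proof -
      have seg: "\<bar>y - x\<bar> \<le> \<bar>u - x\<bar>" if "y \<in> closed_segment x u" for y
        using that by (auto simp: closed_segment_eq_real_ivl split: if_splits)
      have "norm ((f u - poly Q u) - (f x - poly Q x)) \<le> \<epsilon> * \<bar>u - x\<bar> ^ Suc r * norm (u - x)"
      proof (rule field_differentiable_bound[where S = "closed_segment x u" and f' = "\<lambda>y. deriv f y - poly P y"])
        fix y assume y: "y \<in> closed_segment x u"
        have "f differentiable (at y)"
          using Suc.prems(1)[of 0 y] seg[OF y] u by (simp add: dist_real_def abs_minus_commute)
        then have "(f has_real_derivative deriv f y) (at y)"
          by (simp add: DERIV_deriv_iff_real_differentiable)
        from DERIV_diff[OF this poly_DERIV[of Q y]]
        show "((\<lambda>u. f u - poly Q u) has_real_derivative deriv f y - poly P y) (at y within closed_segment x u)"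
          unfolding Q(1) by (rule has_field_derivative_at_within)
        have "norm (deriv f y - poly P y) \<le> \<epsilon> * \<bar>y - x\<bar> ^ Suc r"
          using d(2)[of y] seg[OF y] u by simp
        also have "\<dots> \<le> \<epsilon> * \<bar>u - x\<bar> ^ Suc r"
          using seg[OF y] \<epsilon> by (intro mult_left_mono power_mono) auto
        finally show "norm (deriv f y - poly P y) \<le> \<epsilon> * \<bar>u - x\<bar> ^ Suc r" .
      qed auto
      then show ?thesis using Q(4) by (simp add: mult_ac)
    qed
    moreover have "min d e > 0" using d(1) assms(1) by simp
    ultimately show ?thesis by blast
  qed
  moreover have "fact (Suc (Suc r)) * coeff Q (Suc (Suc r)) = (deriv ^^ Suc (Suc r)) f x"
  proof -
    have "fact (Suc (Suc r)) * coeff Q (Suc (Suc r)) = fact (Suc r) * coeff P (Suc r)"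
      unfolding Q(3) fact_Suc[of "Suc r"] by (simp del: fact_Suc of_nat_Suc)
    then show ?thesis unfolding P(2) shift .
  qed
  ultimately show ?case using Q(2) by blast
qed

section \<open>Growth bounds and domination\<close>

lemma poly_growth:
  fixes P :: "real poly"
  assumes "degree P \<le> N"
  shows "\<exists>A\<ge>0. \<forall>u\<ge>0. \<bar>poly P u\<bar> \<le> A * (1 + u) ^ N"
proof (intro exI conjI allI impI)
  show "0 \<le> (\<Sum>i\<le>degree P. \<bar>coeff P i\<bar>)" by (intro sum_nonneg) auto
  fix u :: real assume u: "u \<ge> 0"
  have "\<bar>poly P u\<bar> \<le> (\<Sum>i\<le>degree P. \<bar>coeff P i * u ^ i\<bar>)"
    unfolding poly_altdef by (rule sum_abs)
  also have "\<dots> \<le> (\<Sum>i\<le>degree P. \<bar>coeff P i\<bar> * (1 + u) ^ N)"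
  proof (intro sum_mono)
    fix i assume i: "i \<in> {..degree P}"
    have "u ^ i \<le> (1 + u) ^ i" using u by (intro power_mono) auto
    also have "\<dots> \<le> (1 + u) ^ N" using u i assms by (intro power_increasing) auto
    finally show "\<bar>coeff P i * u ^ i\<bar> \<le> \<bar>coeff P i\<bar> * (1 + u) ^ N"
      using u by (auto simp: abs_mult intro!: mult_left_mono)
  qed
  finally show "\<bar>poly P u\<bar> \<le> (\<Sum>i\<le>degree P. \<bar>coeff P i\<bar>) * (1 + u) ^ N" by (simp add: sum_distrib_right)
qed

text \<open>The base is 1 + u rather than u because the exponent can be raised from \<mu> to N only
  for a base at least 1.\<close>

lemma C_mu_growth:
  assumes "f \<in> C_mu \<mu>" "\<mu> > 0" "\<mu> \<le> real N"
  shows "\<exists>A\<ge>0. \<forall>u\<ge>0. \<bar>f u\<bar> \<le> A * (1 + u) ^ N"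
proof -
  obtain M where M: "M > 0" "\<And>u. u \<ge> 0 \<Longrightarrow> \<bar>f u\<bar> \<le> M * u powr \<mu>"
    using assms(1) by (auto simp: C_mu_def)
  have "\<bar>f u\<bar> \<le> M * (1 + u) ^ N" if u: "u \<ge> 0" for u
  proof -
    have "u powr \<mu> \<le> (1 + u) powr \<mu>" using u assms(2) by (intro powr_mono2) auto
    also have "\<dots> \<le> (1 + u) powr real N" using u assms(3) by (intro powr_mono) auto
    also have "\<dots> = (1 + u) ^ N" using u by (intro powr_realpow) auto
    finally have "M * u powr \<mu> \<le> M * (1 + u) ^ N" using M(1) by (intro mult_left_mono) auto
    with M(2)[OF u] show ?thesis by linarith
  qed
  then show ?thesis using M(1) by (intro exI[of _ M]) auto
qed

lemma bdk_ok:
  assumes "\<gamma> > 0" "0 \<le> \<alpha>" "0 \<le> \<beta>" "n > 0" "\<gamma> * real N \<le> real n" "continuous_on {0..} h"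
    and "\<And>u. u \<ge> 0 \<Longrightarrow> \<bar>h u\<bar> \<le> A * (1 + u) ^ N"
  shows "dur_ok \<gamma> n k (\<lambda>t. h ((real n * t + \<alpha>) / (real n + \<beta>)))"
proof -
  define p where "p = smult A ([:1 + \<alpha> / (real n + \<beta>), real n / (real n + \<beta>):] ^ N)"
  have dp: "degree p \<le> N"
  proof -
    have "degree p \<le> degree ([:1 + \<alpha> / (real n + \<beta>), real n / (real n + \<beta>):] ^ N)"
      unfolding p_def by (rule degree_smult_le)
    also have "\<dots> \<le> 1 * N"
      by (rule order_trans[OF degree_power_le]) (auto intro: mult_right_mono)
    finally show ?thesis by simp
  qed
  have nonneg: "(real n * t + \<alpha>) / (real n + \<beta>) \<ge> 0" if "t \<ge> 0" for t using that assms by simp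
  show ?thesis
  proof (rule dur_ok_bounded[OF assms(1,4), where p = p])
    have ne: "real n + \<beta> \<noteq> 0" using assms by simp
    have "continuous_on {0..} (\<lambda>t. (real n * t + \<alpha>) / (real n + \<beta>))"
      by (intro continuous_intros) (use ne in auto)
    then show "continuous_on {0..} (\<lambda>t. h ((real n * t + \<alpha>) / (real n + \<beta>)))"
      by (rule continuous_on_compose2[OF assms(6)]) (use nonneg in auto)
    show "\<bar>h ((real n * t + \<alpha>) / (real n + \<beta>))\<bar> \<le> poly p t" if "t \<ge> 0" for t
    proof -
      have "poly p t = A * (1 + (real n * t + \<alpha>) / (real n + \<beta>)) ^ N"
        by (simp add: p_def poly_power add_divide_distrib algebra_simps)
      then show ?thesis using assms(7)[OF nonneg[OF that]] by simp
    qed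
    have "\<gamma> * real (degree p) \<le> \<gamma> * real N" using dp assms(1) by (intro mult_left_mono) auto
    then show "\<gamma> * real (degree p) \<le> real n" using assms(5) by linarith
  qed
qed

text \<open>At distance at least d from x the quantity 1 + u is at most a constant times |u - x|, so
  the growth bound itself becomes a power of |u - x|. The constant C depends on d, hence on
  \<epsilon>.\<close>

lemma local_to_global_bound:
  fixes h :: "real \<Rightarrow> real"
  assumes "x \<ge> 0" "d > 0" "\<epsilon> \<ge> 0" "A \<ge> 0"
    and "\<And>u. u \<ge> 0 \<Longrightarrow> \<bar>h u\<bar> \<le> A * (1 + u) ^ N" "\<And>u. \<bar>u - x\<bar> < d \<Longrightarrow> \<bar>h u\<bar> \<le> \<epsilon> * \<bar>u - x\<bar> ^ r"
  shows "\<exists>C\<ge>0. \<forall>u\<ge>0. \<bar>h u\<bar> \<le> \<epsilon> * \<bar>u - x\<bar> ^ r + C * \<bar>u - x\<bar> ^ N"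
proof -
  define B where "B = (1 + x) / d + 1"
  have B: "B \<ge> 0" using assms by (simp add: B_def)
  have "\<bar>h u\<bar> \<le> \<epsilon> * \<bar>u - x\<bar> ^ r + A * B ^ N * \<bar>u - x\<bar> ^ N" if u: "u \<ge> 0" for u
  proof (cases "\<bar>u - x\<bar> < d")
    case True
    have "A * B ^ N * \<bar>u - x\<bar> ^ N \<ge> 0" using assms(4) B by simp
    then show ?thesis using assms(6)[OF True] by linarith
  next
    case False
    have "1 + u \<le> (1 + x) * 1 + \<bar>u - x\<bar>" by simp
    also have "\<dots> \<le> (1 + x) * (\<bar>u - x\<bar> / d) + \<bar>u - x\<bar>"
      using False assms(1,2) by (intro add_right_mono mult_left_mono) auto
    also have "\<dots> = B * \<bar>u - x\<bar>" by (simp add: B_def algebra_simps)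
    finally have "(1 + u) ^ N \<le> (B * \<bar>u - x\<bar>) ^ N" using u by (intro power_mono) auto
    then have "A * (1 + u) ^ N \<le> A * B ^ N * \<bar>u - x\<bar> ^ N"
      using mult_left_mono[OF _ assms(4)] by (simp add: power_mult_distrib mult.assoc)
    moreover have "\<epsilon> * \<bar>u - x\<bar> ^ r \<ge> 0" using assms(3) by simp
    ultimately show ?thesis using assms(5)[OF u] by linarith
  qed
  then show ?thesis using assms(4) B by (intro exI[of _ "A * B ^ N"]) auto
qed

section \<open>Complex extension of the operator\<close>

text \<open>Expanding in powers of \<open>\<gamma> z / (1 + \<gamma> z)\<close> makes the kernel a power series with nonnegative
  coefficients, so its modulus is controlled by its value at a real point.\<close>

definition cbas :: "real \<Rightarrow> nat \<Rightarrow> (nat \<Rightarrow> real) \<Rightarrow> complex \<Rightarrow> complex" where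
  "cbas \<gamma> n d z = (1 + of_real \<gamma> * z) powr (- of_real (real n / \<gamma>)) *
     (\<Sum>k. of_real (pochhammer (real n / \<gamma>) k / fact k * d k) * (of_real \<gamma> * z / (1 + of_real \<gamma> * z)) ^ k)"

text \<open>\<xi> is the real point whose ratio \<gamma> \<xi> / (1 + \<gamma> \<xi>) equals \<rho>;
  a power series at radius \<rho> thus has the weights at \<xi> as terms, up to a common
  factor.\<close>

lemma p_bas_geometric:
  fixes \<rho> :: real
  assumes "\<gamma> > 0" "n > 0" "0 \<le> \<rho>" "\<rho> < 1"
  defines "\<xi> \<equiv> \<rho> / (\<gamma> * (1 - \<rho>))"
  shows "\<xi> \<ge> 0" "pochhammer (real n / \<gamma>) k / fact k * \<rho> ^ k = (1 - \<rho>) powr (- (real n / \<gamma>)) * p_bas n k \<gamma> \<xi>"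
proof -
  show x: "\<xi> \<ge> 0" using assms by (simp add: \<xi>_def)
  have y: "\<gamma> * \<xi> = \<rho> / (1 - \<rho>)" using assms by (simp add: \<xi>_def)
  have 1: "1 + \<gamma> * \<xi> = 1 / (1 - \<rho>)" using assms(4) unfolding y by (simp add: field_simps)
  have 2: "\<gamma> * \<xi> / (1 + \<gamma> * \<xi>) = \<rho>" unfolding 1 unfolding y using assms(4) by simp
  have "(1 / (1 - \<rho>)) powr (- (real n / \<gamma>)) = (1 - \<rho>) powr (real n / \<gamma>)"
    using assms(4) by (simp add: powr_divide powr_minus)
  moreover have "(1 - \<rho>) powr (- (real n / \<gamma>)) * (1 - \<rho>) powr (real n / \<gamma>) = 1"
    using assms(4) by (simp add: powr_minus)
  ultimately show "pochhammer (real n / \<gamma>) k / fact k * \<rho> ^ k = (1 - \<rho>) powr (- (real n / \<gamma>)) * p_bas n k \<gamma> \<xi>"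
    unfolding p_bas_eq[OF assms(1,2) x] 2 unfolding 1 by simp
qed

lemma cbas_coeff_summable:
  fixes w :: complex
  assumes "\<gamma> > 0" "n > 0" "\<And>\<xi>. \<xi> \<ge> 0 \<Longrightarrow> summable (\<lambda>k. p_bas n k \<gamma> \<xi> * \<bar>d k\<bar>)" "norm w < 1"
  defines "\<xi> \<equiv> norm w / (\<gamma> * (1 - norm w))"
  shows "summable (\<lambda>k. norm (of_real (pochhammer (real n / \<gamma>) k / fact k * d k) * w ^ k))"
    and "norm (\<Sum>k. of_real (pochhammer (real n / \<gamma>) k / fact k * d k) * w ^ k)
      \<le> (1 - norm w) powr (- (real n / \<gamma>)) * (\<Sum>k. p_bas n k \<gamma> \<xi> * \<bar>d k\<bar>)"
proof -
  note G = p_bas_geometric[OF assms(1,2) norm_ge_zero assms(4), folded \<xi>_def]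
  have poch: "pochhammer (real n / \<gamma>) k / fact k \<ge> 0" for k
    using assms(1,2) by (auto intro!: divide_nonneg_nonneg pochhammer_nonneg divide_pos_pos)
  have eq: "norm (of_real (pochhammer (real n / \<gamma>) k / fact k * d k) * w ^ k) =
      (1 - norm w) powr (- (real n / \<gamma>)) * (p_bas n k \<gamma> \<xi> * \<bar>d k\<bar>)" for k
  proof -
    have "norm (of_real (pochhammer (real n / \<gamma>) k / fact k * d k) * w ^ k) =
      (pochhammer (real n / \<gamma>) k / fact k) * norm w ^ k * \<bar>d k\<bar>"
      unfolding norm_mult norm_of_real norm_power abs_mult abs_of_nonneg[OF poch] by simp
    then show ?thesis unfolding G(2) by simp
  qed
  note S = assms(3)[OF G(1)]
  show sm: "summable (\<lambda>k. norm (of_real (pochhammer (real n / \<gamma>) k / fact k * d k) * w ^ k))"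
    unfolding eq by (rule summable_mult[OF S])
  have "norm (\<Sum>k. of_real (pochhammer (real n / \<gamma>) k / fact k * d k) * w ^ k)
    \<le> (\<Sum>k. norm (of_real (pochhammer (real n / \<gamma>) k / fact k * d k) * w ^ k))"
    by (rule summable_norm[OF sm])
  also have "\<dots> = (1 - norm w) powr (- (real n / \<gamma>)) * (\<Sum>k. p_bas n k \<gamma> \<xi> * \<bar>d k\<bar>)"
    unfolding eq by (rule suminf_mult[OF S])
  finally show "norm (\<Sum>k. of_real (pochhammer (real n / \<gamma>) k / fact k * d k) * w ^ k)
      \<le> (1 - norm w) powr (- (real n / \<gamma>)) * (\<Sum>k. p_bas n k \<gamma> \<xi> * \<bar>d k\<bar>)" .
qed

text \<open>Sends the right half plane into the unit disc under v / (1 + v), and makes the gap |1 +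
  v| - |v| positive.\<close>

lemma cmod_less_cmod_add_one:
  assumes "Re v > 0"
  shows "cmod v < cmod (1 + v)"
proof (rule power2_less_imp_less)
  show "(cmod v)\<^sup>2 < (cmod (1 + v))\<^sup>2"
    using assms unfolding cmod_power2 by (simp add: power2_eq_square algebra_simps)
qed simp

lemma cbas_holomorphic:
  assumes "\<gamma> > 0" "n > 0" "\<And>\<xi>. \<xi> \<ge> 0 \<Longrightarrow> summable (\<lambda>k. p_bas n k \<gamma> \<xi> * \<bar>d k\<bar>)"
  shows "cbas \<gamma> n d holomorphic_on {z. Re z > 0}"
proof -
  define G where "G = (\<lambda>w::complex. \<Sum>k. of_real (pochhammer (real n / \<gamma>) k / fact k * d k) * w ^ k)"
  have G: "G holomorphic_on ball 0 1"
  proof (rule power_series_holomorphic)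
    fix w :: complex assume "w \<in> ball 0 1"
    then have "norm w < 1" by simp
    from summable_norm_cancel[OF cbas_coeff_summable(1)[OF assms this]]
    show "(\<lambda>k. of_real (pochhammer (real n / \<gamma>) k / fact k * d k) * (w - 0) ^ k) sums G w"
      unfolding G_def by (simp add: summable_sums)
  qed
  have re: "Re (of_real \<gamma> * z) > 0" if "Re z > 0" for z using that assms(1) by simp
  \<comment> \<open>The half plane keeps 1 + \<gamma> z off the branch cut of the principal
    power.\<close>
  have ne: "1 + of_real \<gamma> * z \<noteq> 0" "1 + of_real \<gamma> * z \<notin> \<real>\<^sub>\<le>\<^sub>0" if "Re z > 0" for z
  proof -
    have "Re (1 + of_real \<gamma> * z) > 0" using re[OF that] by simp
    then show "1 + of_real \<gamma> * z \<notin> \<real>\<^sub>\<le>\<^sub>0" unfolding complex_nonpos_Reals_iff by linarith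
    then show "1 + of_real \<gamma> * z \<noteq> 0" by auto
  qed
  have "(\<lambda>z. G (of_real \<gamma> * z / (1 + of_real \<gamma> * z))) holomorphic_on {z. Re z > 0}"
  proof (rule holomorphic_on_compose_gen[OF _ G, unfolded o_def])
    show "(\<lambda>z. of_real \<gamma> * z / (1 + of_real \<gamma> * z)) holomorphic_on {z. Re z > 0}"
      using ne by (intro holomorphic_intros) auto
    show "(\<lambda>z. of_real \<gamma> * z / (1 + of_real \<gamma> * z)) ` {z. Re z > 0} \<subseteq> ball 0 1"
    proof safe
      fix z :: complex assume z: "Re z > 0"
      then show "of_real \<gamma> * z / (1 + of_real \<gamma> * z) \<in> ball 0 1"
        using cmod_less_cmod_add_one[OF re[OF z]] by (simp add: norm_divide divide_less_eq_1)
    qed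
  qed
  then show ?thesis
    unfolding cbas_def G_def using ne by (intro holomorphic_intros) auto
qed

lemma cbas_of_real:
  assumes "\<gamma> > 0" "n > 0" "\<And>\<xi>. \<xi> \<ge> 0 \<Longrightarrow> summable (\<lambda>k. p_bas n k \<gamma> \<xi> * \<bar>d k\<bar>)" "y > 0"
  shows "cbas \<gamma> n d (of_real y) = of_real (\<Sum>k. p_bas n k \<gamma> y * d k)"
proof -
  define m where "m = real n / \<gamma>"
  define w where "w = \<gamma> * y / (1 + \<gamma> * y)"
  have gy: "1 + \<gamma> * y > 0" using assms by (simp add: add_pos_pos)
  have w: "0 \<le> w" "w < 1" using assms gy by (auto simp: w_def)
  have "norm (of_real w :: complex) < 1" using w by simp
  from summable_norm_cancel[OF cbas_coeff_summable(1)[OF assms(1-3) this]]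
  have "summable (\<lambda>k. complex_of_real (pochhammer m k / fact k * d k * w ^ k))" by (simp add: m_def)
  then have sm: "summable (\<lambda>k. pochhammer m k / fact k * d k * w ^ k)"
    by (simp only: summable_of_real_iff)
  have "(\<Sum>k. p_bas n k \<gamma> y * d k) = (\<Sum>k. (1 + \<gamma> * y) powr (-m) * (pochhammer m k / fact k * d k * w ^ k))"
    unfolding p_bas_eq[OF assms(1,2) less_imp_le[OF assms(4)]] m_def[symmetric] w_def[symmetric]
    by (simp add: mult_ac)
  also have "\<dots> = (1 + \<gamma> * y) powr (-m) * (\<Sum>k. pochhammer m k / fact k * d k * w ^ k)"
    by (rule suminf_mult[OF sm])
  finally have "of_real (\<Sum>k. p_bas n k \<gamma> y * d k) = 
    complex_of_real ((1 + \<gamma> * y) powr (-m)) * (\<Sum>k. complex_of_real (pochhammer m k / fact k * d k * w ^ k))"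
    by (simp only: of_real_mult suminf_of_real[OF sm])
  also have "complex_of_real ((1 + \<gamma> * y) powr (-m)) = (1 + of_real \<gamma> * of_real y) powr (- of_real m)"
    using powr_of_real[of "1 + \<gamma> * y" "-m"] gy by simp
  also have "(\<lambda>k. complex_of_real (pochhammer m k / fact k * d k * w ^ k)) =
      (\<lambda>k. of_real (pochhammer m k / fact k * d k) * (of_real \<gamma> * of_real y / (1 + of_real \<gamma> * of_real y)) ^ k)"
    by (simp add: w_def fun_eq_iff)
  finally show ?thesis unfolding cbas_def m_def by simp
qed

text \<open>With v = \<gamma> z and w = v / (1 + v) one has 1 - |w| = D / |1 + v|. Hence the modulus
  of the prefactor and the power of 1 - |w| from the series merge into a power of D, and the real
  point of ratio |w| is |z| / D. On the positive axis D = 1 and that point is z itself.\<close>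

lemma cbas_bound:
  assumes "\<gamma> > 0" "n > 0" "\<And>\<xi>. \<xi> \<ge> 0 \<Longrightarrow> summable (\<lambda>k. p_bas n k \<gamma> \<xi> * \<bar>d k\<bar>)" "Re z > 0"
  defines "D \<equiv> cmod (1 + of_real \<gamma> * z) - cmod (of_real \<gamma> * z)"
  shows "cmod (cbas \<gamma> n d z) \<le> D powr (- (real n / \<gamma>)) * (\<Sum>k. p_bas n k \<gamma> (cmod z / D) * \<bar>d k\<bar>)"
proof -
  define v where "v = of_real \<gamma> * z"
  define w where "w = v / (1 + v)"
  have rv: "Re v > 0" using assms by (simp add: v_def)
  have D: "D > 0" using cmod_less_cmod_add_one[OF rv] by (simp add: D_def v_def)
  have ne: "cmod (1 + v) > 0" using cmod_less_cmod_add_one[OF rv] norm_ge_zero[of v] by linarith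
  have w1: "1 - norm w = D / cmod (1 + v)"
    unfolding w_def D_def v_def[symmetric] norm_divide using ne by (simp add: diff_divide_distrib)
  then have w: "norm w < 1" using D ne by (metis diff_gt_0_iff_gt divide_pos_pos)
  have \<xi>: "norm w / (\<gamma> * (1 - norm w)) = cmod z / D"
    unfolding w1 using ne D assms(1) by (simp add: w_def norm_divide v_def norm_mult)
  have "norm (\<Sum>k. of_real (pochhammer (real n / \<gamma>) k / fact k * d k) * w ^ k)
      \<le> (1 - norm w) powr (- (real n / \<gamma>)) * (\<Sum>k. p_bas n k \<gamma> (cmod z / D) * \<bar>d k\<bar>)"
    using cbas_coeff_summable(2)[OF assms(1-3) w] unfolding \<xi> .
  moreover have "cmod ((1 + v) powr (- of_real (real n / \<gamma>))) = cmod (1 + v) powr (- (real n / \<gamma>))"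
    by (subst norm_powr_real_powr') (auto simp: Reals_minus)
  ultimately have "cmod (cbas \<gamma> n d z) \<le> cmod (1 + v) powr (- (real n / \<gamma>)) *
    ((1 - norm w) powr (- (real n / \<gamma>)) * (\<Sum>k. p_bas n k \<gamma> (cmod z / D) * \<bar>d k\<bar>))"
    unfolding cbas_def v_def[symmetric] w_def[symmetric] norm_mult
    by (simp add: mult_left_mono)
  also have "\<dots> = (cmod (1 + v) * (1 - norm w)) powr (- (real n / \<gamma>)) * (\<Sum>k. p_bas n k \<gamma> (cmod z / D) * \<bar>d k\<bar>)"
    using ne w by (subst powr_mult) auto
  also have "cmod (1 + v) * (1 - norm w) = D" unfolding w1 using ne by simp
  finally show ?thesis .
qed

text \<open>First-order bound for the square root, with the lower bound p in place of Re v so that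
  the same correction serves v and 1 + v.\<close>

lemma cmod_le_Re_add:
  assumes "0 < p" "p \<le> Re v"
  shows "cmod v \<le> Re v + (Im v)\<^sup>2 / (2 * p)"
proof (rule power2_le_imp_le)
  have "(Im v)\<^sup>2 * 1 \<le> (Im v)\<^sup>2 * (Re v / p)" using assms by (intro mult_left_mono) auto
  also have "\<dots> = 2 * Re v * ((Im v)\<^sup>2 / (2 * p))" by simp
  finally have "(Im v)\<^sup>2 \<le> 2 * Re v * ((Im v)\<^sup>2 / (2 * p))" by simp
  then show "(cmod v)\<^sup>2 \<le> (Re v + (Im v)\<^sup>2 / (2 * p))\<^sup>2"
    unfolding cmod_power2 power2_sum by (smt (verit) zero_le_power2)
qed (use assms in auto)

text \<open>Since \<open>(cmod (1 + v))\<^sup>2 - (cmod v)\<^sup>2 = 1 + 2 * Re v\<close>, the gap deviates from its value \<open>1\<close>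
  on the positive axis only to second order in \<open>Im v\<close>.\<close>

lemma inverse_cmod_gap_le:
  assumes "0 < p" "p \<le> Re v"
  shows "1 / (cmod (1 + v) - cmod v) \<le> 1 + (Im v)\<^sup>2 / p" "cmod (1 + v) - cmod v \<le> 1"
proof -
  define E where "E = (Im v)\<^sup>2 / (2 * p)"
  have E: "E \<ge> 0" using assms by (simp add: E_def)
  have rv: "Re v > 0" using assms by linarith
  have pos: "cmod (1 + v) - cmod v > 0" using cmod_less_cmod_add_one[OF rv] by simp
  have "cmod v \<le> Re v + E" "cmod (1 + v) \<le> 1 + Re v + E"
    using cmod_le_Re_add[of p v] cmod_le_Re_add[of p "1 + v"] assms by (auto simp: E_def)
  then have "cmod (1 + v) + cmod v \<le> (1 + 2 * Re v) + 2 * E" by simp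
  also have "\<dots> \<le> (1 + 2 * Re v) * (1 + 2 * E)" using E rv by (simp add: algebra_simps)
  finally have 1: "cmod (1 + v) + cmod v \<le> (1 + 2 * Re v) * (1 + 2 * E)" .
  have "(cmod (1 + v) - cmod v) * (cmod (1 + v) + cmod v) = (cmod (1 + v))\<^sup>2 - (cmod v)\<^sup>2"
    by (simp add: power2_eq_square algebra_simps)
  also have "\<dots> = 1 + 2 * Re v" unfolding cmod_power2 by (simp add: power2_eq_square algebra_simps)
  finally have "1 + 2 * Re v \<le> (cmod (1 + v) - cmod v) * ((1 + 2 * Re v) * (1 + 2 * E))"
    using mult_left_mono[OF 1, of "cmod (1 + v) - cmod v"] pos by simp
  then have "(1 + 2 * Re v) * 1 \<le> (1 + 2 * Re v) * ((cmod (1 + v) - cmod v) * (1 + 2 * E))"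
    by (simp add: mult_ac)
  then have "1 \<le> (cmod (1 + v) - cmod v) * (1 + 2 * E)" using rv by (subst (asm) mult_le_cancel_left_pos) auto
  then show "1 / (cmod (1 + v) - cmod v) \<le> 1 + (Im v)\<^sup>2 / p"
    using pos by (simp add: E_def divide_le_eq mult.commute)
  show "cmod (1 + v) - cmod v \<le> 1" using norm_triangle_ineq[of 1 v] by simp
qed

text \<open>Since s \<le> x/2, the circle stays in Re z \<ge> x/2, so 1/D \<le> 1 + 2 \<gamma> s^2 /
  x; raised to the power n/\<gamma> this is at most exp (2 n s^2 / x), and n s^2 = 1. In the
  displacement, 1 accounts for | |z| - x | \<le> s, and 3 \<gamma> for the product of |z| \<le> 3x/2
  with the excess 2 \<gamma> s^2 / x, where s^2 \<le> s.\<close>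

lemma circle_geometry:
  fixes \<gamma> x s :: real and n :: nat
  assumes \<gamma>: "\<gamma> > 0" and x: "x > 0" and s: "0 < s" "s \<le> x / 2" "s \<le> 1" and n: "real n * s\<^sup>2 = 1"
    and z: "cmod (of_real x - z) = s"
  defines "D \<equiv> cmod (1 + of_real \<gamma> * z) - cmod (of_real \<gamma> * z)"
  shows "Re z > 0" "D powr (- (real n / \<gamma>)) \<le> exp (2 / x)" "\<bar>cmod z / D - x\<bar> \<le> (1 + 3 * \<gamma>) * s" "cmod z / D \<ge> 0"
proof -
  have "\<bar>Re (of_real x - z)\<bar> \<le> s" "\<bar>Im (of_real x - z)\<bar> \<le> s"
    using abs_Re_le_cmod[of "of_real x - z"] abs_Im_le_cmod[of "of_real x - z"] z by auto
  then have rez: "x / 2 \<le> Re z" and imz: "\<bar>Im z\<bar> \<le> s" using s by auto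
  show rz: "Re z > 0" using rez x by linarith
  define v where "v = of_real \<gamma> * z"
  define p where "p = \<gamma> * x / 2"
  have p: "0 < p" "p \<le> Re v" using \<gamma> x rez by (auto simp: p_def v_def field_simps)
  note G = inverse_cmod_gap_le[OF p, folded D_def[folded v_def]]
  have D: "D > 0" using cmod_less_cmod_add_one[of v] p by (simp add: D_def v_def)
  have "(Im v)\<^sup>2 \<le> (\<gamma> * s)\<^sup>2"
    using imz \<gamma> by (auto simp: v_def abs_mult intro!: power2_le_iff_abs_le[THEN iffD2] mult_left_mono)
  then have "(Im v)\<^sup>2 / p \<le> (\<gamma> * s)\<^sup>2 / p" using p by (intro divide_right_mono) auto
  also have "\<dots> = 2 * \<gamma> * s\<^sup>2 / x" using \<gamma> by (simp add: p_def power2_eq_square)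
  finally have G1: "1 / D \<le> 1 + 2 * \<gamma> * s\<^sup>2 / x" using G(1) by linarith
  have D1: "1 \<le> 1 / D" using G(2) D by simp
  have "D powr (- (real n / \<gamma>)) = (1 / D) powr (real n / \<gamma>)"
    using D by (simp add: powr_divide powr_minus_divide)
  also have "\<dots> \<le> (1 + 2 * \<gamma> * s\<^sup>2 / x) powr (real n / \<gamma>)"
    using G1 D \<gamma> by (intro powr_mono2) auto
  also have "\<dots> \<le> exp (2 * \<gamma> * s\<^sup>2 / x) powr (real n / \<gamma>)"
    using \<gamma> x by (intro powr_mono2 exp_ge_add_one_self) (auto intro!: add_nonneg_nonneg)
  also have "\<dots> = exp (2 * (real n * s\<^sup>2) / x)" using \<gamma> by (simp add: powr_def mult_ac)
  finally show "D powr (- (real n / \<gamma>)) \<le> exp (2 / x)" unfolding n by simp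
  have zx: "\<bar>cmod z - x\<bar> \<le> s"
    using norm_triangle_ineq3[of z "of_real x"] z x by (simp add: norm_minus_commute)
  have "cmod z * (1 / D - 1) \<le> (3 / 2 * x) * (2 * \<gamma> * s\<^sup>2 / x)"
    using zx s G1 D1 x by (intro mult_mono) auto
  also have "\<dots> = 3 * \<gamma> * s * s" using x by (simp add: power2_eq_square)
  also have "\<dots> \<le> 3 * \<gamma> * s * 1" using s \<gamma> by (intro mult_left_mono) auto
  finally have "cmod z / D - cmod z \<le> 3 * \<gamma> * s" by (simp add: algebra_simps)
  moreover have "0 \<le> cmod z * (1 / D - 1)" using D1 by simp
  then have "0 \<le> cmod z / D - cmod z" by (simp add: algebra_simps)
  ultimately show "\<bar>cmod z / D - x\<bar> \<le> (1 + 3 * \<gamma>) * s" using zx by (simp add: algebra_simps)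
  show "cmod z / D \<ge> 0" using D by simp
qed

text \<open>The identity must be carried for all positive x at once, since the next derivative needs
  it on a neighbourhood. The induction also establishes differentiability, so each
  \<open>deriv\<close> of g is a genuine derivative.\<close>

lemma higher_deriv_Re_holomorphic:
  fixes g :: "real \<Rightarrow> real" and R :: "real poly" and F :: "complex \<Rightarrow> complex"
  assumes "F holomorphic_on {z. Re z > 0}" "\<And>y. y > 0 \<Longrightarrow> g y = poly R y + Re (F (of_real y))" "x > 0"
  shows "(deriv ^^ j) g x = poly ((pderiv ^^ j) R) x + Re ((deriv ^^ j) F (of_real x))"
  using assms(3)
proof (induction j arbitrary: x)
  case 0
  then show ?case by (simp add: assms(2))
next
  case (Suc j)
  have op: "open {z::complex. Re z > 0}" by (rule open_halfspace_Re_gt)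
  have "(deriv ^^ j) F holomorphic_on {z. Re z > 0}" by (rule holomorphic_higher_deriv[OF assms(1) op])
  then have "((deriv ^^ j) F has_field_derivative deriv ((deriv ^^ j) F) (of_real x)) (at (of_real x))"
    by (rule holomorphic_derivI[OF _ op]) (use Suc.prems in auto)
  then have "((\<lambda>y. (deriv ^^ j) F (of_real y)) has_vector_derivative deriv ((deriv ^^ j) F) (of_real x)) (at x)"
    by (rule has_vector_derivative_real_field)
  then have "((\<lambda>y. Re ((deriv ^^ j) F (of_real y))) has_real_derivative Re (deriv ((deriv ^^ j) F) (of_real x))) (at x)"
    unfolding has_real_derivative_iff_has_vector_derivative
    by (rule bounded_linear.has_vector_derivative[OF bounded_linear_Re])
  then have "((\<lambda>y. poly ((pderiv ^^ j) R) y + Re ((deriv ^^ j) F (of_real y))) has_real_derivative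
    poly (pderiv ((pderiv ^^ j) R)) x + Re (deriv ((deriv ^^ j) F) (of_real x))) (at x)"
    by (intro DERIV_add poly_DERIV)
  then have "((deriv ^^ j) g has_real_derivative
    poly (pderiv ((pderiv ^^ j) R)) x + Re (deriv ((deriv ^^ j) F) (of_real x))) (at x)"
    by (rule has_field_derivative_transform_within_open[where S = "{0<..}"]) (use Suc in auto)
  from DERIV_imp_deriv[OF this] show ?case by simp
qed

lemma poly_higher_pderiv_degree:
  fixes R :: "real poly"
  assumes "degree R \<le> r"
  shows "poly ((pderiv ^^ r) R) x = fact r * coeff R r"
proof -
  have "degree ((pderiv ^^ r) R) = 0" using assms by (simp add: degree_higher_pderiv)
  then obtain c where c: "(pderiv ^^ r) R = [:c:]" by (rule degree_eq_zeroE)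
  have "c = coeff ((pderiv ^^ r) R) 0" by (simp add: c)
  also have "\<dots> = fact r * coeff R r" by (simp add: coeff_higher_pderiv pochhammer_fact)
  finally show ?thesis by (simp add: c)
qed

section \<open>The remainder term\<close>

lemma bdk_abs_le:
  assumes "\<gamma> > 0" "0 \<le> \<alpha>" "0 \<le> \<beta>" "n > 0"
    and "dur_ok \<gamma> n k (\<lambda>t. h ((real n * t + \<alpha>) / (real n + \<beta>)))"
    and "dur_ok \<gamma> n k (\<lambda>t. g ((real n * t + \<alpha>) / (real n + \<beta>)))"
    and "\<And>u. u \<ge> 0 \<Longrightarrow> \<bar>h u\<bar> \<le> g u"
  shows "\<bar>bdk \<gamma> \<alpha> \<beta> n k h\<bar> \<le> bdk \<gamma> \<alpha> \<beta> n k g"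
proof -
  have "(real n * t + \<alpha>) / (real n + \<beta>) \<ge> 0" if "t \<ge> 0" for t using that assms by simp
  then show ?thesis
    unfolding bdk_def
    using assms(7) dur_abs[OF assms(1,5)]
    by (intro order_trans[OF dur_abs(2)[OF assms(1,5)]] dur_mono assms(1,6)) auto
qed

text \<open>Domination by the polynomial A (1 + u)^N, whose series is already known to
  converge.\<close>

lemma bdk_summable:
  assumes "\<gamma> > 0" "0 \<le> \<alpha>" "0 \<le> \<beta>" "n > 0" "\<gamma> * real N \<le> real n" "continuous_on {0..} h"
    and "\<And>u. u \<ge> 0 \<Longrightarrow> \<bar>h u\<bar> \<le> A * (1 + u) ^ N" and "\<xi> \<ge> 0"
  shows "summable (\<lambda>k. p_bas n k \<gamma> \<xi> * \<bar>bdk \<gamma> \<alpha> \<beta> n k h\<bar>)"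
proof -
  define P where "P = smult A ([:1, 1:] ^ N)"
  have P: "poly P u = A * (1 + u) ^ N" for u by (simp add: P_def poly_power)
  have dP: "degree P \<le> N"
    unfolding P_def by (rule order_trans[OF degree_smult_le]) (simp add: degree_linear_power)
  obtain R where R: "(\<lambda>k. p_bas n k \<gamma> \<xi> * bdk \<gamma> \<alpha> \<beta> n k (poly P)) sums poly R \<xi>"
    using bdk_poly_sums[OF assms(1,3,4) dP assms(5), of \<alpha>] assms(8) by blast
  have A: "A \<ge> 0" using assms(7)[of 0] by auto
  have "\<bar>bdk \<gamma> \<alpha> \<beta> n k h\<bar> \<le> bdk \<gamma> \<alpha> \<beta> n k (poly P)" for k
  proof (rule bdk_abs_le[OF assms(1-4)])
    show "dur_ok \<gamma> n k (\<lambda>t. h ((real n * t + \<alpha>) / (real n + \<beta>)))"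
      by (rule bdk_ok[OF assms(1-7)])
    show "dur_ok \<gamma> n k (\<lambda>t. poly P ((real n * t + \<alpha>) / (real n + \<beta>)))"
      by (rule bdk_ok[OF assms(1-5), where A = A]) (use A in \<open>auto simp: P intro!: continuous_intros\<close>)
    show "\<bar>h u\<bar> \<le> poly P u" if "u \<ge> 0" for u using assms(7)[OF that] by (simp add: P)
  qed
  then show ?thesis
    using p_bas_nonneg[OF assms(1,4,8)]
    by (intro summable_comparison_test'[OF sums_summable[OF R], of 0]) (auto simp: abs_mult intro!: mult_left_mono)
qed

text \<open>Only even moments are available, so with w = sqrt n |u - x| the power w^r is replaced by
  1 + w^(2r). In the far term r < 2N leaves a factor 1 / sqrt n, which later beats the constant C
  however small \<epsilon> is.\<close>

lemma remainder_sum_bound: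
  assumes \<gamma>: "\<gamma> > 0" and \<alpha>\<beta>: "0 \<le> \<alpha>" "0 \<le> \<beta>" and n: "n > 0" and \<xi>: "\<xi> \<ge> 0"
    and N: "r < 2 * N" "\<gamma> * real (2 * r) \<le> real n" "\<gamma> * real (2 * N) \<le> real n"
    and ok: "\<And>k. dur_ok \<gamma> n k (\<lambda>t. h ((real n * t + \<alpha>) / (real n + \<beta>)))"
    and \<epsilon>: "\<epsilon> \<ge> 0" "C \<ge> 0"
    and h: "\<And>u. u \<ge> 0 \<Longrightarrow> \<bar>h u\<bar> \<le> \<epsilon> * \<bar>u - x\<bar> ^ r + C * \<bar>u - x\<bar> ^ (2 * N)"
    and M1: "summable (\<lambda>k. p_bas n k \<gamma> \<xi> * bdk \<gamma> \<alpha> \<beta> n k (\<lambda>u. (u - x) ^ (2 * r)))"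
      "sqrt (real n) ^ (2 * r) * (\<Sum>k. p_bas n k \<gamma> \<xi> * bdk \<gamma> \<alpha> \<beta> n k (\<lambda>u. (u - x) ^ (2 * r))) \<le> C1"
    and M2: "summable (\<lambda>k. p_bas n k \<gamma> \<xi> * bdk \<gamma> \<alpha> \<beta> n k (\<lambda>u. (u - x) ^ (2 * N)))"
      "sqrt (real n) ^ (2 * N) * (\<Sum>k. p_bas n k \<gamma> \<xi> * bdk \<gamma> \<alpha> \<beta> n k (\<lambda>u. (u - x) ^ (2 * N))) \<le> C2"
  shows "sqrt (real n) ^ r * (\<Sum>k. p_bas n k \<gamma> \<xi> * \<bar>bdk \<gamma> \<alpha> \<beta> n k h\<bar>) \<le> \<epsilon> * (1 + C1) + C * C2 / sqrt (real n)"
proof -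
  define \<rho> where "\<rho> = sqrt (real n)"
  have \<rho>: "\<rho> \<ge> 1" using n by (simp add: \<rho>_def)
  define p where "p = (\<lambda>k. p_bas n k \<gamma> \<xi>)"
  have p: "p k \<ge> 0" for k unfolding p_def by (rule p_bas_nonneg[OF \<gamma> n \<xi>])
  define I where "I = (\<lambda>s k. bdk \<gamma> \<alpha> \<beta> n k (\<lambda>u. (u - x) ^ (2 * s)))"
  have pw: "\<rho> ^ r * \<bar>h u\<bar> \<le> \<epsilon> * (1 + \<rho> ^ (2 * r) * (u - x) ^ (2 * r)) + C / \<rho> * (\<rho> ^ (2 * N) * (u - x) ^ (2 * N))"
    if u: "u \<ge> 0" for u
  proof -
    define w where "w = \<rho> * \<bar>u - x\<bar>"
    have "2 * w ^ r \<le> 1 + (w ^ r)\<^sup>2"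
      using zero_le_power2[of "w ^ r - 1"] by (simp add: power2_eq_square algebra_simps)
    moreover have "w ^ r \<ge> 0" using \<rho> by (simp add: w_def)
    ultimately have "w ^ r \<le> 1 + w ^ (2 * r)" by (simp add: power_mult mult.commute)
    moreover have ws: "w ^ (2 * s) = \<rho> ^ (2 * s) * (u - x) ^ (2 * s)" for s
      by (simp add: w_def power_mult_distrib power_even_abs)
    ultimately have 1: "\<epsilon> * w ^ r \<le> \<epsilon> * (1 + \<rho> ^ (2 * r) * (u - x) ^ (2 * r))"
      using \<epsilon> by (intro mult_left_mono) auto
    have "\<rho> ^ r \<le> \<rho> ^ (2 * N - 1)" using \<rho> N by (intro power_increasing) auto
    also have "\<dots> = \<rho> ^ (2 * N) / \<rho>" using \<rho> N by (simp add: power_diff)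
    finally have 2: "C * \<bar>u - x\<bar> ^ (2 * N) * \<rho> ^ r \<le> C * \<bar>u - x\<bar> ^ (2 * N) * (\<rho> ^ (2 * N) / \<rho>)"
      using \<epsilon> by (intro mult_left_mono) auto
    have "\<rho> ^ r * \<bar>h u\<bar> \<le> \<rho> ^ r * (\<epsilon> * \<bar>u - x\<bar> ^ r + C * \<bar>u - x\<bar> ^ (2 * N))"
      using h[OF u] \<rho> by (intro mult_left_mono) auto
    also have "\<dots> = \<epsilon> * w ^ r + C * \<bar>u - x\<bar> ^ (2 * N) * \<rho> ^ r"
      by (simp add: w_def power_mult_distrib algebra_simps)
    finally show ?thesis using 1 2 by (simp add: power_even_abs mult_ac)
  qed
  have bound: "\<rho> ^ r * \<bar>bdk \<gamma> \<alpha> \<beta> n k h\<bar> \<le> \<epsilon> * (1 + \<rho> ^ (2 * r) * I r k) + C / \<rho> * (\<rho> ^ (2 * N) * I N k)" for k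
  proof -
    let ?u = "\<lambda>t. (real n * t + \<alpha>) / (real n + \<beta>)"
    have ok1: "dur_ok \<gamma> n k (\<lambda>t. t ^ 0)" and v1: "dur \<gamma> n k (\<lambda>t. t ^ 0) = 1"
      using dur_power[OF \<gamma> n, of 0 k] by (auto simp: mom_def)
    note okr = bdk_central_ok[OF \<gamma> n N(2), of k \<alpha> \<beta> x] and okN = bdk_central_ok[OF \<gamma> n N(3), of k \<alpha> \<beta> x]
    note a = dur_cmult[OF okr, of "\<rho> ^ (2 * r)"]
    note b = dur_add[OF ok1 a(1)]
    note c = dur_cmult[OF b(1), of \<epsilon>]
    note d = dur_cmult[OF dur_cmult(1)[OF okN, of "\<rho> ^ (2 * N)"], of "C / \<rho>"]
    note e = dur_add[OF c(1) d(1)]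
    have "\<rho> ^ r * \<bar>bdk \<gamma> \<alpha> \<beta> n k h\<bar> = \<bar>bdk \<gamma> \<alpha> \<beta> n k (\<lambda>u. \<rho> ^ r * h u)\<bar>"
      unfolding bdk_def dur_cmult(2)[OF ok] using \<rho> by (simp add: abs_mult)
    also have "\<dots> \<le> bdk \<gamma> \<alpha> \<beta> n k (\<lambda>u. \<epsilon> * (1 + \<rho> ^ (2 * r) * (u - x) ^ (2 * r)) + C / \<rho> * (\<rho> ^ (2 * N) * (u - x) ^ (2 * N)))"
    proof (rule bdk_abs_le[OF \<gamma> \<alpha>\<beta> n])
      show "dur_ok \<gamma> n k (\<lambda>t. \<rho> ^ r * h (?u t))" by (rule dur_cmult[OF ok])
      show "dur_ok \<gamma> n k (\<lambda>t. \<epsilon> * (1 + \<rho> ^ (2 * r) * (?u t - x) ^ (2 * r)) + C / \<rho> * (\<rho> ^ (2 * N) * (?u t - x) ^ (2 * N)))"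
        using e(1) by simp
      show "\<bar>\<rho> ^ r * h u\<bar> \<le> \<epsilon> * (1 + \<rho> ^ (2 * r) * (u - x) ^ (2 * r)) + C / \<rho> * (\<rho> ^ (2 * N) * (u - x) ^ (2 * N))"
        if "u \<ge> 0" for u
        using pw[OF that] \<rho> by (simp add: abs_mult)
    qed
    also have "\<dots> = \<epsilon> * (1 + \<rho> ^ (2 * r) * I r k) + C / \<rho> * (\<rho> ^ (2 * N) * I N k)"
      using e(2) unfolding c(2) d(2) b(2) a(2) v1 dur_cmult(2)[OF okN] I_def bdk_def by simp
    finally show ?thesis .
  qed
  have sp: "p sums 1"
    using p_bas_falling_sums[OF \<gamma> n \<xi>, of 0] by (simp add: p_def)
  define T where "T = (\<lambda>s. \<Sum>k. p k * I s k)"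
  have T: "(\<lambda>k. p k * I r k) sums T r" "(\<lambda>k. p k * I N k) sums T N"
    using M1(1) M2(1) by (auto simp: T_def p_def I_def summable_sums)
  have S: "(\<lambda>k. \<epsilon> * (p k + \<rho> ^ (2 * r) * (p k * I r k)) + C / \<rho> * (\<rho> ^ (2 * N) * (p k * I N k)))
    sums (\<epsilon> * (1 + \<rho> ^ (2 * r) * T r) + C / \<rho> * (\<rho> ^ (2 * N) * T N))"
    by (intro sums_add sums_mult sp T)
  have le: "\<rho> ^ r * (p k * \<bar>bdk \<gamma> \<alpha> \<beta> n k h\<bar>) \<le>
     \<epsilon> * (p k + \<rho> ^ (2 * r) * (p k * I r k)) + C / \<rho> * (\<rho> ^ (2 * N) * (p k * I N k))" for k
    using mult_left_mono[OF bound[of k] p[of k]] by (simp add: algebra_simps)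
  have sm: "summable (\<lambda>k. \<rho> ^ r * (p k * \<bar>bdk \<gamma> \<alpha> \<beta> n k h\<bar>))"
    using p \<rho> le by (intro summable_comparison_test'[OF sums_summable[OF S], of 0]) auto
  then have sm': "summable (\<lambda>k. p k * \<bar>bdk \<gamma> \<alpha> \<beta> n k h\<bar>)"
    using \<rho> by (subst (asm) summable_cmult_iff) auto
  have "\<rho> ^ r * (\<Sum>k. p k * \<bar>bdk \<gamma> \<alpha> \<beta> n k h\<bar>) = (\<Sum>k. \<rho> ^ r * (p k * \<bar>bdk \<gamma> \<alpha> \<beta> n k h\<bar>))"
    by (rule suminf_mult[OF sm', symmetric])
  also have "\<dots> \<le> \<epsilon> * (1 + \<rho> ^ (2 * r) * T r) + C / \<rho> * (\<rho> ^ (2 * N) * T N)"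
    unfolding sums_unique[OF S] by (intro suminf_le le sm sums_summable[OF S])
  also have "\<dots> \<le> \<epsilon> * (1 + C1) + C / \<rho> * C2"
    using M1(2) M2(2) \<epsilon> \<rho>
    by (intro add_mono mult_left_mono) (auto simp: T_def p_def I_def \<rho>_def)
  finally show ?thesis by (simp add: p_def \<rho>_def)
qed

lemma BDS_eq_poly_plus_cbas:
  assumes \<gamma>: "\<gamma> > 0" and \<alpha>\<beta>: "0 \<le> \<alpha>" "0 \<le> \<beta>" and n: "n > 0" and N: "\<gamma> * real N \<le> real n" and r: "r \<le> N"
    and P: "degree P \<le> r" and f: "continuous_on {0..} f" "\<And>u. u \<ge> 0 \<Longrightarrow> \<bar>f u - poly P u\<bar> \<le> A * (1 + u) ^ N"
  defines "h \<equiv> \<lambda>u. f u - poly P u"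
  shows "\<exists>R. degree R \<le> r \<and> coeff R r = lead_factor \<gamma> \<beta> r n * coeff P r \<and>
    (\<forall>y>0. BDS n \<gamma> \<alpha> \<beta> f y = poly R y + Re (cbas \<gamma> n (\<lambda>k. bdk \<gamma> \<alpha> \<beta> n k h) (of_real y)))"
proof -
  have "\<gamma> * real r \<le> \<gamma> * real N" using r \<gamma> by (intro mult_left_mono) auto
  then have rn: "\<gamma> * real r \<le> real n" using N by linarith
  obtain R where R: "degree R \<le> r" "coeff R r = lead_factor \<gamma> \<beta> r n * coeff P r"
    "\<And>y. y \<ge> 0 \<Longrightarrow> (\<lambda>k. p_bas n k \<gamma> y * bdk \<gamma> \<alpha> \<beta> n k (poly P)) sums poly R y"
    using bdk_poly_sums[OF \<gamma> \<alpha>\<beta>(2) n P rn] by blast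
  have ch: "continuous_on {0..} h" unfolding h_def by (intro continuous_intros f)
  have hA: "\<And>u. u \<ge> 0 \<Longrightarrow> \<bar>h u\<bar> \<le> A * (1 + u) ^ N" unfolding h_def by (rule f(2))
  have S: "summable (\<lambda>k. p_bas n k \<gamma> \<xi> * \<bar>bdk \<gamma> \<alpha> \<beta> n k h\<bar>)" if "\<xi> \<ge> 0" for \<xi>
    by (rule bdk_summable[OF \<gamma> \<alpha>\<beta> n N ch hA that])
  have split: "bdk \<gamma> \<alpha> \<beta> n k f = bdk \<gamma> \<alpha> \<beta> n k (poly P) + bdk \<gamma> \<alpha> \<beta> n k h" for k
  proof -
    obtain A' where A': "\<And>u. u \<ge> 0 \<Longrightarrow> \<bar>poly P u\<bar> \<le> A' * (1 + u) ^ r" using poly_growth[OF P] by blast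
    have "dur_ok \<gamma> n k (\<lambda>t. poly P ((real n * t + \<alpha>) / (real n + \<beta>)))"
      by (rule bdk_ok[OF \<gamma> \<alpha>\<beta> n rn _ A']) (auto intro!: continuous_intros)
    from dur_add(2)[OF this bdk_ok[OF \<gamma> \<alpha>\<beta> n N ch hA]] show ?thesis
      by (simp add: bdk_def h_def)
  qed
  have "BDS n \<gamma> \<alpha> \<beta> f y = poly R y + Re (cbas \<gamma> n (\<lambda>k. bdk \<gamma> \<alpha> \<beta> n k h) (of_real y))" if y: "y > 0" for y
  proof -
    have "summable (\<lambda>k. norm (p_bas n k \<gamma> y * bdk \<gamma> \<alpha> \<beta> n k h))"
      using S[of y] y p_bas_nonneg[OF \<gamma> n less_imp_le[OF y]] by (simp add: abs_mult)
    then have "(\<lambda>k. p_bas n k \<gamma> y * bdk \<gamma> \<alpha> \<beta> n k h) sums (\<Sum>k. p_bas n k \<gamma> y * bdk \<gamma> \<alpha> \<beta> n k h)"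
      by (rule summable_sums[OF summable_norm_cancel])
    from sums_add[OF R(3)[OF less_imp_le[OF y]] this]
    have s: "(\<lambda>k. p_bas n k \<gamma> y * bdk \<gamma> \<alpha> \<beta> n k f) sums (poly R y + (\<Sum>k. p_bas n k \<gamma> y * bdk \<gamma> \<alpha> \<beta> n k h))"
      unfolding split by (simp add: distrib_left)
    have "cbas \<gamma> n (\<lambda>k. bdk \<gamma> \<alpha> \<beta> n k h) (of_real y) = of_real (\<Sum>k. p_bas n k \<gamma> y * bdk \<gamma> \<alpha> \<beta> n k h)"
      by (rule cbas_of_real[OF \<gamma> n S y])
    then show ?thesis
      unfolding BDS_eq_suminf[OF sums_summable[OF s]] sums_unique[OF s, symmetric] by simp
  qed
  with R(1,2) show ?thesis by blast
qed

text \<open>The factor s^(-r) = (sqrt n)^r of Cauchy's inequality is exactly the normalisation in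
  hypothesis B, so no power of n survives. The range of \<xi> in B is the displacement found in
  \<open>circle_geometry\<close>.\<close>

lemma cbas_higher_deriv_bound:
  assumes \<gamma>: "\<gamma> > 0" and n: "n > 0" and x: "x > 0" and s: "1 / sqrt (real n) \<le> x / 2"
    and S: "\<And>\<xi>. \<xi> \<ge> 0 \<Longrightarrow> summable (\<lambda>k. p_bas n k \<gamma> \<xi> * \<bar>d k\<bar>)"
    and B: "\<And>\<xi>. \<xi> \<ge> 0 \<Longrightarrow> sqrt (real n) * \<bar>\<xi> - x\<bar> \<le> 1 + 3 * \<gamma> \<Longrightarrow>
      sqrt (real n) ^ r * (\<Sum>k. p_bas n k \<gamma> \<xi> * \<bar>d k\<bar>) \<le> B"
  shows "norm ((deriv ^^ r) (cbas \<gamma> n d) (of_real x)) \<le> fact r * exp (2 / x) * B"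
proof -
  define \<rho> where "\<rho> = sqrt (real n)"
  have \<rho>: "\<rho> \<ge> 1" using n by (simp add: \<rho>_def)
  define s where "s = 1 / \<rho>"
  have s: "0 < s" "s \<le> x / 2" "s \<le> 1" "real n * s\<^sup>2 = 1"
    using s \<rho> n by (auto simp: s_def \<rho>_def power_divide)
  have holo: "cbas \<gamma> n d holomorphic_on {z. Re z > 0}" by (rule cbas_holomorphic[OF \<gamma> n S])
  have sub: "cball (of_real x) s \<subseteq> {z. Re z > 0}"
  proof
    fix z :: complex assume "z \<in> cball (of_real x) s"
    then have "\<bar>Re (of_real x - z)\<bar> \<le> s"
      using abs_Re_le_cmod[of "of_real x - z"] by (simp add: dist_norm)
    then show "z \<in> {z. Re z > 0}" using s(2) x by auto
  qed
  have "norm ((deriv ^^ r) (cbas \<gamma> n d) (of_real x)) \<le> fact r * (exp (2 / x) * (B / \<rho> ^ r)) / s ^ r"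
  proof (rule Cauchy_inequality[OF _ _ s(1)])
    show "cbas \<gamma> n d holomorphic_on ball (of_real x) s"
      by (rule holomorphic_on_subset[OF holo order_trans[OF ball_subset_cball sub]])
    show "continuous_on (cball (of_real x) s) (cbas \<gamma> n d)"
      by (intro holomorphic_on_imp_continuous_on holomorphic_on_subset[OF holo] sub)
    fix z :: complex assume z: "cmod (of_real x - z) = s"
    define D where "D = cmod (1 + of_real \<gamma> * z) - cmod (of_real \<gamma> * z)"
    define \<xi> where "\<xi> = cmod z / D"
    note G = circle_geometry[OF \<gamma> x s z, folded D_def, folded \<xi>_def]
    have "\<rho> * \<bar>\<xi> - x\<bar> \<le> \<rho> * ((1 + 3 * \<gamma>) * s)" using G(3) \<rho> by (intro mult_left_mono) auto
    also have "\<dots> = 1 + 3 * \<gamma>" using \<rho> by (simp add: s_def)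
    finally have "\<rho> ^ r * (\<Sum>k. p_bas n k \<gamma> \<xi> * \<bar>d k\<bar>) \<le> B"
      unfolding \<rho>_def by (rule B[OF G(4)])
    then have le: "(\<Sum>k. p_bas n k \<gamma> \<xi> * \<bar>d k\<bar>) \<le> B / \<rho> ^ r"
      using \<rho> by (simp add: pos_le_divide_eq mult.commute)
    have nn: "0 \<le> (\<Sum>k. p_bas n k \<gamma> \<xi> * \<bar>d k\<bar>)"
      by (intro suminf_nonneg S G(4) mult_nonneg_nonneg p_bas_nonneg \<gamma> n) auto
    have "cmod (cbas \<gamma> n d z) \<le> D powr (- (real n / \<gamma>)) * (\<Sum>k. p_bas n k \<gamma> \<xi> * \<bar>d k\<bar>)"
      using cbas_bound[OF \<gamma> n S G(1)] unfolding D_def \<xi>_def .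
    also have "\<dots> \<le> exp (2 / x) * (B / \<rho> ^ r)"
      by (rule mult_mono[OF G(2) le _ nn]) simp
    finally show "cmod (cbas \<gamma> n d z) \<le> exp (2 / x) * (B / \<rho> ^ r)" .
  qed
  also have "\<dots> = fact r * exp (2 / x) * B" using \<rho> by (simp add: s_def power_divide)
  finally show ?thesis .
qed

theorem theorem1:
  fixes \<gamma> \<alpha> \<beta> \<mu> x :: real and r :: nat and f :: "real \<Rightarrow> real"
  assumes "\<gamma> > 0" and "0 \<le> \<alpha>" and "\<alpha> \<le> \<beta>" and "\<mu> > 0" and "r \<ge> 1"
    and "f \<in> C_mu \<mu>" and "x > 0"
    and "\<exists>e>0. \<forall>j<r - 1. \<forall>y\<in>ball x e. ((deriv ^^ j) f) differentiable (at y)"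
    and "((deriv ^^ (r - 1)) f) differentiable (at x)"
  shows "(\<lambda>n. (deriv ^^ r) (\<lambda>y. BDS n \<gamma> \<alpha> \<beta> f y) x) \<longlonglongrightarrow> (deriv ^^ r) f x"
proof -
  note \<gamma> = \<open>\<gamma> > 0\<close> and x = \<open>x > 0\<close> and \<alpha> = \<open>0 \<le> \<alpha>\<close>
  have \<beta>: "0 \<le> \<beta>" using assms(2,3) by simp
  obtain e where e: "e > 0" "\<And>j y. j < r - 1 \<Longrightarrow> y \<in> ball x e \<Longrightarrow> ((deriv ^^ j) f) differentiable (at y)"
    using assms(8) by blast
  have r: "Suc (r - 1) = r" using \<open>r \<ge> 1\<close> by simp
  obtain P where P: "degree P \<le> r" "fact r * coeff P r = (deriv ^^ r) f x"
    "\<And>\<epsilon>. \<epsilon> > 0 \<Longrightarrow> \<exists>d>0. \<forall>u. \<bar>u - x\<bar> < d \<longrightarrow> \<bar>f u - poly P u\<bar> \<le> \<epsilon> * \<bar>u - x\<bar> ^ r"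
    using taylor_peano[OF e assms(9)] unfolding r by blast
  define h where "h = (\<lambda>u. f u - poly P u)"
  \<comment> \<open>2N \<ge> \<mu> lets (1 + u)^(2N) dominate \<open>f\<close>, 2N > r gives the
    spare factor 1 / sqrt n, and the exponent 2N is even as the moment bound requires.\<close>
  define N where "N = max r (nat \<lceil>\<mu>\<rceil>)"
  have N: "r \<le> N" "\<mu> \<le> real (2 * N)" "r \<le> 2 * N" "r < 2 * N"
    using \<open>r \<ge> 1\<close> \<open>\<mu> > 0\<close> unfolding N_def by linarith+
  have cf: "continuous_on {0..} f" using assms(6) by (simp add: C_mu_def)
  obtain A where A: "A \<ge> 0" "\<And>u. u \<ge> 0 \<Longrightarrow> \<bar>f u - poly P u\<bar> \<le> A * (1 + u) ^ (2 * N)"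
  proof -
    obtain A1 where A1: "A1 \<ge> 0" "\<And>u. u \<ge> 0 \<Longrightarrow> \<bar>f u\<bar> \<le> A1 * (1 + u) ^ (2 * N)"
      using C_mu_growth[OF assms(6,4) N(2)] by blast
    obtain A2 where A2: "A2 \<ge> 0" "\<And>u. u \<ge> 0 \<Longrightarrow> \<bar>poly P u\<bar> \<le> A2 * (1 + u) ^ (2 * N)"
      using poly_growth[OF order_trans[OF P(1) N(3)]] by blast
    have "\<bar>f u - poly P u\<bar> \<le> (A1 + A2) * (1 + u) ^ (2 * N)" if "u \<ge> 0" for u
      using A1(2)[OF that] A2(2)[OF that] unfolding distrib_right by linarith
    then show ?thesis using that[of "A1 + A2"] A1(1) A2(1) by simp
  qed
  \<comment> \<open>The displacement constant of \<open>circle_geometry\<close>.\<close>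
  define c where "c = 1 + 3 * \<gamma>"
  have c: "c \<ge> 0" using \<gamma> by (simp add: c_def)
  define M where "M = (\<lambda>n \<xi> s. \<Sum>k. p_bas n k \<gamma> \<xi> * bdk \<gamma> \<alpha> \<beta> n k (\<lambda>u. (u - x) ^ (2 * s)))"
  obtain C1 n1 where C1: "C1 \<ge> 0" "\<forall>n\<ge>n1. \<forall>\<xi>\<ge>0. sqrt (real n) * \<bar>\<xi> - x\<bar> \<le> c \<longrightarrow>
    summable (\<lambda>k. p_bas n k \<gamma> \<xi> * bdk \<gamma> \<alpha> \<beta> n k (\<lambda>u. (u - x) ^ (2 * r))) \<and> sqrt (real n) ^ (2 * r) * M n \<xi> r \<le> C1"
    using bdk_moment_bound[OF \<gamma> \<alpha> assms(3) x c, of r] unfolding M_def by (elim exE conjE) (rule that[unfolded M_def]; assumption)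
  obtain C2 n2 where C2: "C2 \<ge> 0" "\<forall>n\<ge>n2. \<forall>\<xi>\<ge>0. sqrt (real n) * \<bar>\<xi> - x\<bar> \<le> c \<longrightarrow>
    summable (\<lambda>k. p_bas n k \<gamma> \<xi> * bdk \<gamma> \<alpha> \<beta> n k (\<lambda>u. (u - x) ^ (2 * N))) \<and> sqrt (real n) ^ (2 * N) * M n \<xi> N \<le> C2"
    using bdk_moment_bound[OF \<gamma> \<alpha> assms(3) x c, of N] unfolding M_def by (elim exE conjE) (rule that[unfolded M_def]; assumption)
  define E where "E = (\<lambda>n. Re ((deriv ^^ r) (cbas \<gamma> n (\<lambda>k. bdk \<gamma> \<alpha> \<beta> n k h)) (of_real x)))"
  have large: "\<forall>\<^sub>F n in sequentially. n > 0 \<and> n \<ge> n1 \<and> n \<ge> n2 \<and> \<gamma> * real (2 * N) \<le> real n \<and> 1 / sqrt (real n) \<le> x / 2"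
  proof (intro eventually_conj)
    have "(\<lambda>n. 1 / sqrt (real n)) \<longlonglongrightarrow> 0" by real_asymp
    then have "\<forall>\<^sub>F n in sequentially. 1 / sqrt (real n) < x / 2"
      using x by (intro order_tendstoD) auto
    then show "\<forall>\<^sub>F n in sequentially. 1 / sqrt (real n) \<le> x / 2" by eventually_elim simp
    show "\<forall>\<^sub>F n in sequentially. \<gamma> * real (2 * N) \<le> real n"
      using filterlim_real_sequentially by (simp add: filterlim_at_top)
  qed (auto simp: eventually_gt_at_top eventually_ge_at_top)
  \<comment> \<open>The r-th derivative of the polynomial part keeps only its coefficient of degree
    r, which is \<open>lead_factor\<close> times that of P; r! times the latter is the r-th
    derivative of f at x.\<close>
  have main: "(deriv ^^ r) (\<lambda>y. BDS n \<gamma> \<alpha> \<beta> f y) x = lead_factor \<gamma> \<beta> r n * (deriv ^^ r) f x + E n"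
    if n: "n > 0" "\<gamma> * real (2 * N) \<le> real n" for n
  proof -
    obtain R where R: "degree R \<le> r" "coeff R r = lead_factor \<gamma> \<beta> r n * coeff P r"
      "\<And>y. y > 0 \<Longrightarrow> BDS n \<gamma> \<alpha> \<beta> f y = poly R y + Re (cbas \<gamma> n (\<lambda>k. bdk \<gamma> \<alpha> \<beta> n k h) (of_real y))"
      using BDS_eq_poly_plus_cbas[OF \<gamma> \<alpha> \<beta> n N(3) P(1) cf A(2)] unfolding h_def by blast
    have ch: "continuous_on {0..} h" unfolding h_def by (intro continuous_intros cf)
    have "cbas \<gamma> n (\<lambda>k. bdk \<gamma> \<alpha> \<beta> n k h) holomorphic_on {z. Re z > 0}"
      by (rule cbas_holomorphic[OF \<gamma> n(1) bdk_summable[OF \<gamma> \<alpha> \<beta> n ch]]) (use A(2) in \<open>auto simp: h_def\<close>)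
    from higher_deriv_Re_holomorphic[OF this R(3) x, of r]
    show ?thesis
      unfolding poly_higher_pderiv_degree[OF R(1)] R(2) P(2)[symmetric] E_def by (simp add: mult_ac)
  qed
  have "E \<longlonglongrightarrow> 0"
  proof (rule tendstoI)
    fix \<eta> :: real assume \<eta>: "\<eta> > 0"
    define K where "K = fact r * exp (2 / x)"
    have K: "K > 0" by (simp add: K_def)
    \<comment> \<open>Makes the near part of the bound exactly \<eta>/2. This is not circular: C1
      and C2 were fixed before \<epsilon>, while C depends on \<epsilon> but is divided by sqrt
      n.\<close>
    define \<epsilon> where "\<epsilon> = \<eta> / (2 * K * (1 + C1))"
    have \<epsilon>: "\<epsilon> > 0" using \<eta> K C1(1) by (simp add: \<epsilon>_def)
    obtain d where d: "d > 0" "\<And>u. \<bar>u - x\<bar> < d \<Longrightarrow> \<bar>h u\<bar> \<le> \<epsilon> * \<bar>u - x\<bar> ^ r"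
      using P(3)[OF \<epsilon>] unfolding h_def by blast
    obtain C where C: "C \<ge> 0" "\<And>u. u \<ge> 0 \<Longrightarrow> \<bar>h u\<bar> \<le> \<epsilon> * \<bar>u - x\<bar> ^ r + C * \<bar>u - x\<bar> ^ (2 * N)"
      using local_to_global_bound[OF less_imp_le[OF x] d(1) less_imp_le[OF \<epsilon>] A(1) _ d(2), of "2 * N"] A(2)
      unfolding h_def by blast
    have "(\<lambda>n. K * (C * C2 / sqrt (real n))) \<longlonglongrightarrow> 0" by real_asymp
    then have "\<forall>\<^sub>F n in sequentially. K * (C * C2 / sqrt (real n)) < \<eta> / 2"
      using \<eta> by (intro order_tendstoD) auto
    with large show "\<forall>\<^sub>F n in sequentially. dist (E n) 0 < \<eta>"
    proof eventually_elim
      case (elim n)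
      then have n: "n > 0" "\<gamma> * real (2 * N) \<le> real n" and s: "1 / sqrt (real n) \<le> x / 2" by auto
      have "\<gamma> * real (2 * r) \<le> \<gamma> * real (2 * N)" using N(1) \<gamma> by (intro mult_left_mono) auto
      then have rn: "\<gamma> * real (2 * r) \<le> real n" using n(2) by linarith
      have ch: "continuous_on {0..} h" unfolding h_def by (intro continuous_intros cf)
      have hA: "\<And>u. u \<ge> 0 \<Longrightarrow> \<bar>h u\<bar> \<le> A * (1 + u) ^ (2 * N)" unfolding h_def by (rule A(2))
      have "norm ((deriv ^^ r) (cbas \<gamma> n (\<lambda>k. bdk \<gamma> \<alpha> \<beta> n k h)) (of_real x))
        \<le> fact r * exp (2 / x) * (\<epsilon> * (1 + C1) + C * C2 / sqrt (real n))"
      proof (rule cbas_higher_deriv_bound[OF \<gamma> n(1) x s bdk_summable[OF \<gamma> \<alpha> \<beta> n ch hA]])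
        fix \<xi> :: real assume \<xi>: "\<xi> \<ge> 0" "sqrt (real n) * \<bar>\<xi> - x\<bar> \<le> 1 + 3 * \<gamma>"
        have "summable (\<lambda>k. p_bas n k \<gamma> \<xi> * bdk \<gamma> \<alpha> \<beta> n k (\<lambda>u. (u - x) ^ (2 * r))) \<and> sqrt (real n) ^ (2 * r) * M n \<xi> r \<le> C1"
          using elim \<xi> by (intro C1(2)[rule_format]) (auto simp: c_def)
        moreover have "summable (\<lambda>k. p_bas n k \<gamma> \<xi> * bdk \<gamma> \<alpha> \<beta> n k (\<lambda>u. (u - x) ^ (2 * N))) \<and> sqrt (real n) ^ (2 * N) * M n \<xi> N \<le> C2"
          using elim \<xi> by (intro C2(2)[rule_format]) (auto simp: c_def)
        ultimately show "sqrt (real n) ^ r * (\<Sum>k. p_bas n k \<gamma> \<xi> * \<bar>bdk \<gamma> \<alpha> \<beta> n k h\<bar>) \<le> \<epsilon> * (1 + C1) + C * C2 / sqrt (real n)"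
          unfolding M_def
          by (intro remainder_sum_bound[OF \<gamma> \<alpha> \<beta> n(1) \<xi>(1) N(4) rn n(2) bdk_ok[OF \<gamma> \<alpha> \<beta> n ch hA] less_imp_le[OF \<epsilon>] C]) auto
      qed
      then have "\<bar>E n\<bar> \<le> K * (\<epsilon> * (1 + C1) + C * C2 / sqrt (real n))"
        unfolding E_def K_def using abs_Re_le_cmod order_trans by blast
      also have "\<dots> = \<eta> / 2 + K * (C * C2 / sqrt (real n))"
      proof -
        have "1 + C1 \<noteq> 0" using C1(1) by simp
        then have "K * (\<epsilon> * (1 + C1)) = \<eta> / 2" using K by (simp add: \<epsilon>_def)
        then show ?thesis by (simp only: distrib_left)
      qed
      also have "\<dots> < \<eta>" using elim by linarith
      finally show ?case by (simp add: dist_real_def)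
    qed
  qed
  from tendsto_add[OF tendsto_mult_right[OF lead_factor_tendsto[of \<gamma> \<beta> r], of "(deriv ^^ r) f x"] this]
  have "(\<lambda>n. lead_factor \<gamma> \<beta> r n * (deriv ^^ r) f x + E n) \<longlonglongrightarrow> (deriv ^^ r) f x" by simp
  moreover have "\<forall>\<^sub>F n in sequentially. lead_factor \<gamma> \<beta> r n * (deriv ^^ r) f x + E n = (deriv ^^ r) (\<lambda>y. BDS n \<gamma> \<alpha> \<beta> f y) x"
    using large by eventually_elim (rule main[symmetric]; simp)
  ultimately show ?thesis by (rule Lim_transform_eventually)
qed

end
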